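(* For $m\in\mathbb Z$ let $R_m(q)=\sum_{\lambda:\ \rho(\lambda)=m}q^{|\lambda|}$ be the generating function for partitions of pairing rank $m$. For every positive integer $k$, $$\det\bigl(R_{i-j}(q)\bigr)_{1\leq i,j\leq k}=\sum_{\ell(\lambda)\leq k}s_\lambda(q^2,q^4,q^6,\ldots)\,s_\lambda(q,q^3,q^5,\ldots),$$ where the sum is over all partitions $\lambda$ with at most $k$ parts and $s_\lambda$ denotes the Schur function.
   Context: For a partition $\lambda$, let $r(\lambda)$ be the largest part size of multiplicity at least $2$ ($r(\lambda)=0$ if $\lambda$ has distinct parts). Let $u_1>u_2>\cdots$ be the part sizes occurring with odd multiplicity, each taken once, and let $s(\lambda)=u_1-u_2+u_3-u_4+\cdots$ ($0$ if there are none). The pairing rank is $\rho(\lambda)=r(\lambda)-s(\lambda)$. $\ell(\lambda)$ is the number of parts of $\lambda$. The Schur functions (not to be confused with the statistic $s(\lambda)$) are evaluated in the infinite alphabets shown, and the identity is one of formal power series in $q$. *)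

theory Defs
  imports
    "HOL-Computational_Algebra.Formal_Power_Series"
    "HOL-Library.FuncSet"
    "HOL-Analysis.Infinite_Sum"
    "Jordan_Normal_Form.Determinant"
begin

(* A partition is the weakly decreasing list of its (positive) parts; its number of parts is
   its length and its size is sum_list. *)
definition int_partition :: "nat list \<Rightarrow> bool" where
  "int_partition \<mu> \<longleftrightarrow> sorted_wrt (\<ge>) \<mu> \<and> (\<forall>p \<in> set \<mu>. 0 < p)"

definition largest_repeated :: "nat list \<Rightarrow> nat" where
  "largest_repeated \<mu> = Max (insert 0 {p \<in> set \<mu>. 2 \<le> count_list \<mu> p})"

fun alt_sum :: "nat list \<Rightarrow> int" where
  "alt_sum [] = 0"
| "alt_sum (u # us) = int u - alt_sum us"

definition odd_parts :: "nat list \<Rightarrow> nat set" where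
  "odd_parts \<mu> = {p \<in> set \<mu>. odd (count_list \<mu> p)}"

definition odd_alt_sum :: "nat list \<Rightarrow> int" where
  "odd_alt_sum \<mu> = alt_sum (rev (sorted_list_of_set (odd_parts \<mu>)))"

definition pairing_rank :: "nat list \<Rightarrow> int" where
  "pairing_rank \<mu> = int (largest_repeated \<mu>) - odd_alt_sum \<mu>"

definition pairing_rank_gf :: "int \<Rightarrow> int fps" where
  "pairing_rank_gf m = Abs_fps (\<lambda>n. int (card
     {\<mu>. int_partition \<mu> \<and> sum_list \<mu> = n \<and> pairing_rank \<mu> = m}))"

definition young_diagram :: "nat list \<Rightarrow> (nat \<times> nat) set" where
  "young_diagram \<mu> = {(i, j). i < length \<mu> \<and> j < \<mu> ! i}"

(* Semistandard Young tableaux with entries in the natural numbers including 0.  They are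
   made undefined off the diagram, so that each tableau is represented by one function. *)
definition ssyt :: "nat list \<Rightarrow> (nat \<times> nat \<Rightarrow> nat) set" where
  "ssyt \<mu> = {T \<in> extensional (young_diagram \<mu>).
     (\<forall>i j j'. (i, j) \<in> young_diagram \<mu> \<and> (i, j') \<in> young_diagram \<mu> \<and> j < j'
        \<longrightarrow> T (i, j) \<le> T (i, j')) \<and>
     (\<forall>i i' j. (i, j) \<in> young_diagram \<mu> \<and> (i', j) \<in> young_diagram \<mu> \<and> i < i'
        \<longrightarrow> T (i, j) < T (i', j))}"

(* The Schur function evaluated at the infinite alphabet x 0, x 1, x 2, ...  The infinite sum
   is taken in the topology of 'a; on fps this is the usual coefficientwise one, and the sum
   converges when x i is a power of fps_X whose positive exponent tends to infinity with i. *)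
definition schur ::
  "(nat \<Rightarrow> 'a::{comm_semiring_1, t2_space}) \<Rightarrow> nat list \<Rightarrow> 'a" where
  "schur x \<mu> = (\<Sum>\<^sub>\<infinity>T\<in>ssyt \<mu>. \<Prod>c\<in>young_diagram \<mu>. x (T c))"

end

theory Submission
  imports Defs "HOL-Library.Multiset"
begin

text \<open>
  Splitting the multiplicities of a partition by parity writes it uniquely as two copies of a
  partition \<open>\<alpha>\<close> together with a set \<open>D\<close> of distinct parts, and the pairing rank is then the
  largest part of \<open>\<alpha>\<close> minus the alternating sum of \<open>D\<close>.  Partitions by largest part are counted by
  the complete symmetric functions \<open>h\<^sub>a(q\<^sup>2, q\<^sup>4, ...)\<close> (conjugation), distinct partitions by
  alternating sum by \<open>h\<^sub>b(q, q\<^sup>3, ...)\<close> (Sylvester).  Hence \<open>R\<^sub>m\<close> is the sum of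
  \<open>h\<^sub>a(q\<^sup>2, q\<^sup>4, ...) h\<^sub>b(q, q\<^sup>3, ...)\<close> over \<open>a - b = m\<close>, and the Toeplitz matrix factors
  into two rectangular matrices of complete symmetric functions.  The Cauchy--Binet formula expands
  its determinant into products of maximal minors, which are Schur functions by the Jacobi--Trudi
  identity.  Convergence is no issue: the coefficient of \<open>q\<^sup>n\<close> only sees the first \<open>n\<close> variables
  and the partitions with parts at most \<open>n\<close>.
\<close>

unbundle fps_syntax
no_notation vec_index (infixl "$" 100)

section \<open>Determinants\<close>

lemma det_mat_cols:
  "det (mat k k (\<lambda>(i, j). A i j)) =
     (\<Sum>p | p permutes {0..<k}. of_int (sign p) * (\<Prod>j<k. A (p j) j))"
proof -
  have "p j < k" if "p permutes {0..<k}" "j < k" for p j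
    using permutes_in_image[OF that(1), of j] that(2) by simp
  then show ?thesis
    by (subst det_col[of _ k]) (auto intro!: sum.cong arg_cong2[of _ _ _ _ "(*)"] prod.cong)
qed

lemma det_cong:
  assumes "\<And>i j. i < k \<Longrightarrow> j < k \<Longrightarrow> A i j = B i j"
  shows "det (mat k k (\<lambda>(i, j). A i j)) = det (mat k k (\<lambda>(i, j). B i j))"
  by (rule arg_cong[of _ _ det], rule cong_mat) (use assms in auto)

text \<open>In the Leibniz expansion each product of column sums is a sum over choice functions
  \<open>f\<close>. The weights \<open>a j (f j)\<close> do not depend on the row, so they leave the
  determinant.\<close>

lemma det_multilinear_cols:
  fixes g :: "nat \<Rightarrow> nat \<Rightarrow> 'b \<Rightarrow> 'a::comm_ring_1"
  assumes fin: "\<And>j. j < k \<Longrightarrow> finite (I j)"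
  shows "det (mat k k (\<lambda>(i, j). \<Sum>v\<in>I j. a j v * g i j v)) =
     (\<Sum>f\<in>PiE {..<k} I. (\<Prod>j<k. a j (f j)) * det (mat k k (\<lambda>(i, j). g i j (f j))))"
proof -
  have "det (mat k k (\<lambda>(i, j). \<Sum>v\<in>I j. a j v * g i j v)) =
      (\<Sum>p | p permutes {0..<k}. of_int (sign p) *
        (\<Sum>f\<in>PiE {..<k} I. \<Prod>j<k. a j (f j) * g (p j) j (f j)))"
    unfolding det_mat_cols using fin by (subst prod_sum_PiE) auto
  also have "\<dots> = (\<Sum>p | p permutes {0..<k}. \<Sum>f\<in>PiE {..<k} I.
      (\<Prod>j<k. a j (f j)) * (of_int (sign p) * (\<Prod>j<k. g (p j) j (f j))))"
    by (simp add: sum_distrib_left prod.distrib mult_ac)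
  also have "\<dots> = (\<Sum>f\<in>PiE {..<k} I. (\<Prod>j<k. a j (f j)) * det (mat k k (\<lambda>(i, j). g i j (f j))))"
    unfolding det_mat_cols by (subst sum.swap) (simp add: sum_distrib_left)
  finally show ?thesis .
qed

text \<open>Right multiplication by a lower bidiagonal matrix with unit diagonal performs all these
  column operations at once, each with the original next column.\<close>

lemma det_sub_next_col:
  fixes A :: "nat \<Rightarrow> nat \<Rightarrow> 'a::comm_ring_1"
  shows "det (mat k k (\<lambda>(i, j). A i j - (if Suc j < k then c j * A i (Suc j) else 0))) =
    det (mat k k (\<lambda>(i, j). A i j))"
proof -
  let ?A = "mat k k (\<lambda>(i, j). A i j)"
  let ?L = "mat k k (\<lambda>(i, j). if i = j then 1 else if i = Suc j then - c j else 0)"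
  have "?A * ?L = mat k k (\<lambda>(i, j). A i j - (if Suc j < k then c j * A i (Suc j) else 0))"
  proof (rule eq_matI)
    fix i j
    assume "i < dim_row (mat k k (\<lambda>(i, j). A i j - (if Suc j < k then c j * A i (Suc j) else 0)))"
      "j < dim_col (mat k k (\<lambda>(i, j). A i j - (if Suc j < k then c j * A i (Suc j) else 0)))"
    then have ij: "i < k" "j < k" by auto
    have "(?A * ?L) $$ (i, j) =
        (\<Sum>l<k. A i l * (if l = j then 1 else if l = Suc j then - c j else 0))"
      using ij by (auto simp: scalar_prod_def lessThan_atLeast0 intro!: sum.cong)
    also have "\<dots> = (\<Sum>l<k. (if l = j then A i l else 0) + (if l = Suc j then - c j * A i l else 0))"
      by (intro sum.cong) auto
    also have "\<dots> = A i j - (if Suc j < k then c j * A i (Suc j) else 0)"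
      using ij by (simp add: sum.distrib)
    finally show "(?A * ?L) $$ (i, j) =
        mat k k (\<lambda>(i, j). A i j - (if Suc j < k then c j * A i (Suc j) else 0)) $$ (i, j)"
      using ij by simp
  qed auto
  moreover have "det ?L = 1"
    by (subst det_lower_triangular[of k]) (auto simp: prod_list_diag_prod)
  ultimately show ?thesis
    using det_mult[of ?A k ?L] by simp
qed

lemma det_permute_cols:
  assumes "p permutes {0..<k}"
  shows "det (mat k k (\<lambda>(i, j). A i (p j))) = of_int (sign p) * det (mat k k (\<lambda>(i, j). A i j))"
proof -
  have pk: "p j < k" if "j < k" for j
    using permutes_in_image[OF assms, of j] that by simp
  have "mat k k (\<lambda>(i, j). A i (p j)) =
      transpose_mat (mat k k (\<lambda>(i, j). transpose_mat (mat k k (\<lambda>(i, j). A i j)) $$ (p i, j)))"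
    by (rule eq_matI) (auto simp: pk)
  then show ?thesis
    by (simp add: det_transpose[of _ k] det_permute_rows[of _ k] assms)
qed

section \<open>The Cauchy--Binet formula\<close>

text \<open>The \<open>k\<close>-element subsets of \<open>{..<n}\<close>, each encoded by its
  decreasing enumeration; extensionality makes the encoding unique. The order is chosen to match
  partitions, whose parts decrease.\<close>

definition decr_funs :: "nat \<Rightarrow> nat \<Rightarrow> (nat \<Rightarrow> nat) set" where
  "decr_funs k n = {f \<in> {..<k} \<rightarrow>\<^sub>E {..<n}. \<forall>i j. i < j \<and> j < k \<longrightarrow> f j < f i}"

lemma finite_decr_funs [simp]: "finite (decr_funs k n)"
  unfolding decr_funs_def by (rule finite_subset[of _ "{..<k} \<rightarrow>\<^sub>E {..<n}"]) (auto intro: finite_PiE)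

lemma decr_funs_inj_on: "f \<in> decr_funs k n \<Longrightarrow> inj_on f {..<k}"
  unfolding decr_funs_def inj_on_def by clarsimp (metis linorder_neqE_nat less_irrefl)

lemma decr_funs_less_iff:
  assumes "f \<in> decr_funs k n" "i < k" "j < k"
  shows "f i < f j \<longleftrightarrow> j < i"
  using assms unfolding decr_funs_def by clarsimp (metis linorder_neqE_nat less_asym less_irrefl)

text \<open>Since \<open>f\<close> decreases, exactly the earlier values exceed \<open>f i\<close>.
  A position can thus be read off from the image set, which is why a set has only one such
  enumeration.\<close>

lemma decr_funs_card_greater:
  assumes "f \<in> decr_funs k n" "i < k"
  shows "card {y \<in> f ` {..<k}. f i < y} = i"
proof -
  have "{y \<in> f ` {..<k}. f i < y} = f ` {..<i}"
    using assms decr_funs_less_iff[OF assms(1) assms(2)] by auto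
  moreover have "inj_on f {..<i}"
    using decr_funs_inj_on[OF assms(1)] by (rule inj_on_subset) (use assms(2) in auto)
  ultimately show ?thesis by (simp add: card_image)
qed

lemma decr_funs_eqI:
  assumes f: "f \<in> decr_funs k n" and g: "g \<in> decr_funs k n" and im: "f ` {..<k} = g ` {..<k}"
  shows "f = g"
proof (rule PiE_ext)
  show "f \<in> {..<k} \<rightarrow>\<^sub>E {..<n}" "g \<in> {..<k} \<rightarrow>\<^sub>E {..<n}"
    using f g by (auto simp: decr_funs_def)
  fix i assume i: "i \<in> {..<k}"
  then obtain l where l: "l < k" "f i = g l" using im by force
  then have "i = l"
    using decr_funs_card_greater[OF f, of i] decr_funs_card_greater[OF g, of l] i im by simp
  then show "f i = g i" using l by simp
qed

lemma decr_funs_enum: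
  assumes "S \<subseteq> {..<n}" "card S = k"
  obtains c where "c \<in> decr_funs k n" "c ` {..<k} = S"
proof
  let ?l = "rev (sorted_list_of_set S)"
  let ?c = "\<lambda>i\<in>{..<k}. ?l ! i"
  have fin: "finite S" using assms(1) finite_subset by blast
  then have len: "length ?l = k" and set: "set ?l = S" using assms(2) by auto
  have s: "sorted_wrt (\<lambda>x y. y < x) ?l"
    by (simp add: sorted_wrt_rev)
  show im: "?c ` {..<k} = S"
    using set len by (auto simp: set_conv_nth in_set_conv_nth image_iff)
  show "?c \<in> decr_funs k n"
    unfolding decr_funs_def
  proof (intro CollectI conjI allI impI)
    show "?c \<in> {..<k} \<rightarrow>\<^sub>E {..<n}" using im assms(1) by auto
    fix i j assume "i < j \<and> j < k"
    then show "?c j < ?c i" using sorted_wrt_nth_less[OF s, of i j] len by auto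
  qed
qed

text \<open>An injective map is determined by its image, listed in decreasing order, and the
  permutation that rearranges this list. This groups the injective terms of the Cauchy--Binet
  expansion by image.\<close>

lemma bij_betw_decr_funs_permutations:
  "bij_betw (\<lambda>(c, p). restrict (c \<circ> p) {..<k}) (decr_funs k n \<times> {p. p permutes {0..<k}})
     {f \<in> {..<k} \<rightarrow>\<^sub>E {..<n}. inj_on f {..<k}}"
proof -
  have pk: "p j < k \<longleftrightarrow> j < k" if "p permutes {0..<k}" for p j
    using permutes_in_image[OF that, of j] by simp
  have pim: "p ` {..<k} = {..<k}" if "p permutes {0..<k}" for p
    using permutes_image[OF that] by (simp add: lessThan_atLeast0)
  show ?thesis
    unfolding bij_betw_def
  proof (intro conjI)
    show "inj_on (\<lambda>(c, p). restrict (c \<circ> p) {..<k}) (decr_funs k n \<times> {p. p permutes {0..<k}})"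
    proof (rule inj_onI, clarify)
      fix c p c' p'
      assume c: "c \<in> decr_funs k n" "c' \<in> decr_funs k n"
        and p: "p permutes {0..<k}" "p' permutes {0..<k}"
        and eq: "restrict (c \<circ> p) {..<k} = restrict (c' \<circ> p') {..<k}"
      have e: "c (p j) = c' (p' j)" if "j < k" for j
        using fun_cong[OF eq, of j] that by simp
      have "c ` {..<k} = (\<lambda>j. c (p j)) ` {..<k}" using pim[OF p(1)] by (metis image_image)
      also have "\<dots> = (\<lambda>j. c' (p' j)) ` {..<k}" using e by auto
      also have "\<dots> = c' ` {..<k}" using pim[OF p(2)] by (metis image_image)
      finally have cc: "c = c'" using decr_funs_eqI c by blast
      moreover have "p j = p' j" for j
      proof (cases "j < k")
        case True
        then show ?thesis
          using e[OF True] cc decr_funs_inj_on[OF c(1)] pk p by (auto simp: inj_on_def)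
      next
        case False
        then show ?thesis using p by (auto simp: permutes_def)
      qed
      ultimately show "c = c' \<and> p = p'" by auto
    qed
    show "(\<lambda>(c, p). restrict (c \<circ> p) {..<k}) ` (decr_funs k n \<times> {p. p permutes {0..<k}}) =
       {f \<in> {..<k} \<rightarrow>\<^sub>E {..<n}. inj_on f {..<k}}"
    proof (intro equalityI subsetI)
      fix f assume "f \<in> (\<lambda>(c, p). restrict (c \<circ> p) {..<k}) ` (decr_funs k n \<times> {p. p permutes {0..<k}})"
      then obtain c p where c: "c \<in> decr_funs k n" and p: "p permutes {0..<k}"
        and f: "f = restrict (c \<circ> p) {..<k}" by auto
      have "inj_on (c \<circ> p) {..<k}"
        using decr_funs_inj_on[OF c] permutes_inj_on[OF p] pim[OF p] by (intro comp_inj_on) auto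
      moreover have "c i < n" if "i < k" for i using c that by (auto simp: decr_funs_def)
      ultimately show "f \<in> {f \<in> {..<k} \<rightarrow>\<^sub>E {..<n}. inj_on f {..<k}}"
        using f pk[OF p] by (auto simp: inj_on_def)
    next
      fix f assume f: "f \<in> {f \<in> {..<k} \<rightarrow>\<^sub>E {..<n}. inj_on f {..<k}}"
      then have "f ` {..<k} \<subseteq> {..<n}" "card (f ` {..<k}) = k"
        by (auto simp: card_image)
      then obtain c where c: "c \<in> decr_funs k n" and im: "c ` {..<k} = f ` {..<k}"
        using decr_funs_enum by metis
      have bc: "bij_betw c {..<k} (f ` {..<k})"
        using decr_funs_inj_on[OF c] im by (auto simp: bij_betw_def)
      have bf: "bij_betw f {..<k} (f ` {..<k})" using f by (auto simp: bij_betw_def)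
      \<comment> \<open>The permutation takes \<open>j\<close> to the position of \<open>f j\<close>
        in the decreasing enumeration and fixes everything outside \<open>{..<k}\<close>, as
        \<open>permutes\<close> demands.\<close>
      let ?p = "\<lambda>j. if j < k then the_inv_into {..<k} c (f j) else j"
      have "bij_betw (the_inv_into {..<k} c \<circ> f) {..<k} {..<k}"
        using bij_betw_trans[OF bf bij_betw_the_inv_into[OF bc]] .
      then have "bij_betw ?p {0..<k} {0..<k}"
        by (subst bij_betw_cong[of _ _ "the_inv_into {..<k} c \<circ> f"]) (auto simp: lessThan_atLeast0)
      then have p: "?p permutes {0..<k}" by (rule bij_imp_permutes) auto
      have "c (?p j) = f j" if "j < k" for j
        using f_the_inv_into_f_bij_betw[OF bc, of "f j"] that by auto
      then have "restrict (c \<circ> ?p) {..<k} = f"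
        using f by (intro ext) (auto simp: PiE_def extensional_def)
      then show "f \<in> (\<lambda>(c, p). restrict (c \<circ> p) {..<k}) ` (decr_funs k n \<times> {p. p permutes {0..<k}})"
        using c p by (intro image_eqI[of _ _ "(c, ?p)"]) auto
    qed
  qed
qed

text \<open>Column \<open>j\<close> of the product combines columns of \<open>A\<close> with
  coefficients \<open>B j c\<close>, so multilinearity expands the determinant over all maps
  \<open>f\<close>. Maps with a repeated value give equal columns and vanish; when the others are
  grouped by image, the signed permutations sum to the minor of \<open>B\<close>.\<close>

theorem cauchy_binet:
  fixes A B :: "nat \<Rightarrow> nat \<Rightarrow> 'a::comm_ring_1"
  shows "det (mat k k (\<lambda>(i, j). \<Sum>c<n. A i c * B j c)) =
    (\<Sum>f\<in>decr_funs k n. det (mat k k (\<lambda>(i, j). A i (f j))) * det (mat k k (\<lambda>(i, j). B i (f j))))"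
proof -
  let ?P = "{p. p permutes {0..<k}}"
  let ?A = "\<lambda>f. det (mat k k (\<lambda>(i, j). A i (f j)))"
  have pk: "p j < k" if "p permutes {0..<k}" "j < k" for p j
    using permutes_in_image[OF that(1), of j] that(2) by simp
  have rows: "det (mat k k (\<lambda>(i, j). B i (f j))) =
      (\<Sum>p\<in>?P. of_int (sign p) * (\<Prod>j<k. B j (f (p j))))" for f
    by (subst det_def'[of _ k])
       (auto simp: pk lessThan_atLeast0 intro!: sum.cong arg_cong2[of _ _ _ _ "(*)"] prod.cong)
  have "det (mat k k (\<lambda>(i, j). \<Sum>c<n. A i c * B j c)) =
      (\<Sum>f\<in>{..<k} \<rightarrow>\<^sub>E {..<n}. (\<Prod>j<k. B j (f j)) * ?A f)"
    using det_multilinear_cols[of k "\<lambda>_. {..<n}" "\<lambda>j c. B j c" "\<lambda>i j c. A i c"]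
    by (simp add: mult.commute)
  also have "\<dots> = (\<Sum>f\<in>{f \<in> {..<k} \<rightarrow>\<^sub>E {..<n}. inj_on f {..<k}}. (\<Prod>j<k. B j (f j)) * ?A f)"
  proof (rule sum.mono_neutral_right)
    show "\<forall>f\<in>({..<k} \<rightarrow>\<^sub>E {..<n}) - {f \<in> {..<k} \<rightarrow>\<^sub>E {..<n}. inj_on f {..<k}}.
      (\<Prod>j<k. B j (f j)) * ?A f = 0"
    proof
      fix f assume "f \<in> ({..<k} \<rightarrow>\<^sub>E {..<n}) - {f \<in> {..<k} \<rightarrow>\<^sub>E {..<n}. inj_on f {..<k}}"
      then obtain i j where "i < k" "j < k" "i \<noteq> j" "f i = f j" by (auto simp: inj_on_def)
      then have "?A f = 0" by (intro det_identical_columns[of _ k i j]) auto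
      then show "(\<Prod>j<k. B j (f j)) * ?A f = 0" by simp
    qed
  qed (auto intro: finite_PiE)
  also have "\<dots> = (\<Sum>(c, p)\<in>decr_funs k n \<times> ?P.
      (\<Prod>j<k. B j (restrict (c \<circ> p) {..<k} j)) * ?A (restrict (c \<circ> p) {..<k}))"
    by (subst sum.reindex_bij_betw[OF bij_betw_decr_funs_permutations, symmetric])
       (simp add: case_prod_unfold)
  also have "\<dots> = (\<Sum>(c, p)\<in>decr_funs k n \<times> ?P.
      ?A c * (of_int (sign p) * (\<Prod>j<k. B j (c (p j)))))"
  proof (rule sum.cong[OF refl], clarify)
    fix c p assume p: "p permutes {0..<k}"
    have "?A (restrict (c \<circ> p) {..<k}) = det (mat k k (\<lambda>(i, j). A i (c (p j))))"
      by (rule det_cong) auto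
    also have "\<dots> = of_int (sign p) * ?A c"
      by (rule det_permute_cols[OF p, of "\<lambda>i j. A i (c j)"])
    finally show "(\<Prod>j<k. B j (restrict (c \<circ> p) {..<k} j)) * ?A (restrict (c \<circ> p) {..<k}) =
       ?A c * (of_int (sign p) * (\<Prod>j<k. B j (c (p j))))"
      by (simp add: mult_ac)
  qed
  also have "\<dots> = (\<Sum>f\<in>decr_funs k n. ?A f * det (mat k k (\<lambda>(i, j). B i (f j))))"
    by (simp add: rows sum_distrib_left sum.cartesian_product)
  finally show ?thesis .
qed

section \<open>The Jacobi--Trudi identity\<close>

text \<open>\<open>complete_sym x N a\<close> is \<open>h\<^sub>a\<close> in the \<open>N\<close> variables \<open>x 0, ..., x (N - 1)\<close>.\<close>

fun complete_sym :: "(nat \<Rightarrow> 'a::comm_semiring_1) \<Rightarrow> nat \<Rightarrow> nat \<Rightarrow> 'a" where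
  "complete_sym x N 0 = 1"
| "complete_sym x 0 (Suc a) = 0"
| "complete_sym x (Suc N) (Suc a) = complete_sym x N (Suc a) + x N * complete_sym x (Suc N) a"

text \<open>Negative indices occur in Jacobi--Trudi entries; the value zero there keeps
  \<open>complete_sym_int_Suc\<close> true at every integer.\<close>

definition complete_sym_int :: "(nat \<Rightarrow> 'a::comm_semiring_1) \<Rightarrow> nat \<Rightarrow> int \<Rightarrow> 'a" where
  "complete_sym_int x N r = (if r < 0 then 0 else complete_sym x N (nat r))"

lemma complete_sym_int_0: "complete_sym_int x 0 r = (if r = 0 then 1 else 0)"
  by (cases "nat r") (auto simp: complete_sym_int_def)

lemma complete_sym_int_Suc:
  "complete_sym_int x (Suc N) r = complete_sym_int x N r + x N * complete_sym_int x (Suc N) (r - 1)"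
proof (cases "r \<le> 0")
  case False
  then have "nat r = Suc (nat (r - 1))" by simp
  with False show ?thesis by (simp add: complete_sym_int_def)
qed (auto simp: complete_sym_int_def)

text \<open>Iterating \<open>complete_sym_int_Suc\<close> from index \<open>m + s\<close> down to
  \<open>l + s\<close> leaves one remainder at index \<open>l - 1 + s\<close>. The free shift
  \<open>s\<close> will be the offset \<open>i - j\<close> of a determinant entry.\<close>

lemma complete_sym_int_telescope:
  fixes x :: "nat \<Rightarrow> 'a::comm_ring_1"
  assumes "l \<le> m"
  shows "complete_sym_int x (Suc N) (int m + s)
      - x N ^ Suc (m - l) * complete_sym_int x (Suc N) (int l - 1 + s) =
    (\<Sum>v=l..m. x N ^ (m - v) * complete_sym_int x N (int v + s))"
  using assms
proof (induction m rule: dec_induct)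
  case base
  then show ?case
    using complete_sym_int_Suc[of x N "int l + s"] by (simp add: algebra_simps)
next
  case (step m)
  have "(\<Sum>v=l..Suc m. x N ^ (Suc m - v) * complete_sym_int x N (int v + s)) =
      x N * (\<Sum>v=l..m. x N ^ (m - v) * complete_sym_int x N (int v + s))
      + complete_sym_int x N (int (Suc m) + s)"
    using step.hyps by (simp add: sum_distrib_left Suc_diff_le mult.assoc)
  then show ?case
    using complete_sym_int_Suc[of x N "int (Suc m) + s"] step
    by (simp add: algebra_simps Suc_diff_le flip: step.IH)
qed

text \<open>The transpose of the usual matrix: part \<open>m j\<close> belongs to column
  \<open>j\<close>, where the column operations act. Zero parts are allowed, so \<open>k\<close> may
  exceed the number of parts.\<close>

definition jacobi_trudi :: "(nat \<Rightarrow> 'a::comm_ring_1) \<Rightarrow> nat \<Rightarrow> nat \<Rightarrow> (nat \<Rightarrow> nat) \<Rightarrow> 'a" where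
  "jacobi_trudi x N k m =
     det (mat k k (\<lambda>(i, j). complete_sym_int x N (int (m j) + (int i - int j))))"

definition decreasing_rows :: "nat \<Rightarrow> (nat \<Rightarrow> nat) \<Rightarrow> bool" where
  "decreasing_rows k m \<longleftrightarrow> (\<forall>i j. i \<le> j \<and> j < k \<longrightarrow> m j \<le> m i)"

text \<open>For weakly decreasing \<open>m\<close>, these are the shapes \<open>f\<close> such that
  \<open>m / f\<close> is a horizontal strip, that is, has at most one cell in each column.\<close>

definition interlacing :: "nat \<Rightarrow> (nat \<Rightarrow> nat) \<Rightarrow> (nat \<Rightarrow> nat) set" where
  "interlacing k m = PiE {..<k} (\<lambda>j. {(if Suc j < k then m (Suc j) else 0)..m j})"

lemma finite_interlacing [simp]: "finite (interlacing k m)"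
  unfolding interlacing_def by (intro finite_PiE) auto

lemma interlacing_bounds:
  assumes "f \<in> interlacing k m" "i < k"
  shows "f i \<in> {(if Suc i < k then m (Suc i) else 0)..m i}"
  using PiE_mem[OF assms(1)[unfolded interlacing_def], of i] assms(2) by simp

lemma interlacing_le: "f \<in> interlacing k m \<Longrightarrow> i < k \<Longrightarrow> f i \<le> m i"
  using interlacing_bounds[of f k m i] by simp

lemma interlacing_ge:
  assumes "decreasing_rows k m" "f \<in> interlacing k m" "i < j" "j < k"
  shows "m j \<le> f i"
proof -
  have "m (Suc i) \<le> f i" using interlacing_bounds[OF assms(2), of i] assms(3,4) by (simp split: if_splits)
  moreover have "m j \<le> m (Suc i)" using assms by (auto simp: decreasing_rows_def)
  ultimately show ?thesis by simp
qed

lemma interlacing_decreasing: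
  assumes "decreasing_rows k m" "f \<in> interlacing k m"
  shows "decreasing_rows k f"
  unfolding decreasing_rows_def
proof (intro allI impI, elim conjE)
  fix i j assume "i \<le> j" "j < k"
  then show "f j \<le> f i"
    using interlacing_ge[OF assms, of i j] interlacing_le[OF assms(2), of j]
    by (cases "i = j") auto
qed

text \<open>Without variables only index zero gives a nonzero entry. The empty shape thus yields the
  identity matrix; otherwise \<open>m 0 > 0\<close>, so column \<open>0\<close> has only positive
  indices and vanishes.\<close>

lemma jacobi_trudi_0:
  assumes "decreasing_rows k m"
  shows "jacobi_trudi x 0 k m = (if \<forall>j<k. m j = 0 then 1 else 0)"
proof (cases "\<forall>j<k. m j = 0")
  case True
  have "mat k k (\<lambda>(i, j). complete_sym_int x 0 (int (m j) + (int i - int j))) = 1\<^sub>m k"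
    using True by (intro eq_matI) (auto simp: complete_sym_int_0)
  then show ?thesis using True by (simp add: jacobi_trudi_def)
next
  case False
  then have "0 < k" "m 0 > 0" using assms by (force simp: decreasing_rows_def)+
  then have "(\<Prod>j<k. complete_sym_int x 0 (int (m j) + (int (p j) - int j))) = 0" for p
    by (intro prod_zero bexI[of _ 0]) (auto simp: complete_sym_int_0)
  then show ?thesis using False by (simp add: jacobi_trudi_def det_mat_cols)
qed

text \<open>Subtracting from each column a multiple of the next one cuts the geometric sum expressing
  its entries through the first \<open>N\<close> variables down to the interlacing range.\<close>

lemma jacobi_trudi_Suc:
  fixes x :: "nat \<Rightarrow> 'a::comm_ring_1"
  assumes "decreasing_rows k m"
  shows "jacobi_trudi x (Suc N) k m =
    (\<Sum>f\<in>interlacing k m. (\<Prod>j<k. x N ^ (m j - f j)) * jacobi_trudi x N k f)"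
proof -
  let ?h = "complete_sym_int x"
  let ?l = "\<lambda>j. if Suc j < k then m (Suc j) else 0"
  let ?A = "\<lambda>i j. ?h (Suc N) (int (m j) + (int i - int j))"
  have "jacobi_trudi x (Suc N) k m =
      det (mat k k (\<lambda>(i, j). ?A i j - (if Suc j < k then x N ^ Suc (m j - ?l j) * ?A i (Suc j) else 0)))"
    unfolding jacobi_trudi_def by (rule det_sub_next_col[symmetric])
  also have "\<dots> = det (mat k k (\<lambda>(i, j). \<Sum>v=?l j..m j. x N ^ (m j - v) * ?h N (int v + (int i - int j))))"
  proof (rule det_cong)
    fix i j assume ij: "i < k" "j < k"
    have "?l j \<le> m j" using assms ij by (auto simp: decreasing_rows_def)
    from complete_sym_int_telescope[OF this, of x N "int i - int j"]
    have "(\<Sum>v=?l j..m j. x N ^ (m j - v) * ?h N (int v + (int i - int j))) =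
      ?A i j - x N ^ Suc (m j - ?l j) * ?h (Suc N) (int (?l j) - 1 + (int i - int j))" by simp
    \<comment> \<open>The remainder of the telescoped sum is the entry in the next column; in the
      last column its index is \<open>i - k\<close>, which is negative, so nothing is subtracted
      there.\<close>
    moreover have "?h (Suc N) (int (?l j) - 1 + (int i - int j)) = (if Suc j < k then ?A i (Suc j) else 0)"
      using ij by (auto simp: complete_sym_int_def algebra_simps)
    ultimately show "?A i j - (if Suc j < k then x N ^ Suc (m j - ?l j) * ?A i (Suc j) else 0) =
      (\<Sum>v=?l j..m j. x N ^ (m j - v) * ?h N (int v + (int i - int j)))"
      by simp
  qed
  also have "\<dots> = (\<Sum>f\<in>interlacing k m. (\<Prod>j<k. x N ^ (m j - f j)) * jacobi_trudi x N k f)"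
    unfolding interlacing_def jacobi_trudi_def
    by (rule det_multilinear_cols[of k "\<lambda>j. {?l j..m j}" "\<lambda>j v. x N ^ (m j - v)"
          "\<lambda>i j v. ?h N (int v + (int i - int j))"]) auto
  finally show ?thesis .
qed

section \<open>Semistandard tableaux and the branching rule for Schur polynomials\<close>

definition diagram :: "nat \<Rightarrow> (nat \<Rightarrow> nat) \<Rightarrow> (nat \<times> nat) set" where
  "diagram k m = (SIGMA i:{..<k}. {..<m i})"

lemma mem_diagram [simp]: "(i, j) \<in> diagram k m \<longleftrightarrow> i < k \<and> j < m i"
  by (auto simp: diagram_def)

lemma finite_diagram [simp]: "finite (diagram k m)"
  by (simp add: diagram_def)

definition semistandard :: "(nat \<times> nat) set \<Rightarrow> (nat \<times> nat \<Rightarrow> nat) set" where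
  "semistandard D = {T \<in> extensional D.
     (\<forall>i j j'. (i, j) \<in> D \<and> (i, j') \<in> D \<and> j < j' \<longrightarrow> T (i, j) \<le> T (i, j')) \<and>
     (\<forall>i i' j. (i, j) \<in> D \<and> (i', j) \<in> D \<and> i < i' \<longrightarrow> T (i, j) < T (i', j))}"

definition bounded_tableaux :: "nat \<Rightarrow> (nat \<times> nat) set \<Rightarrow> (nat \<times> nat \<Rightarrow> nat) set" where
  "bounded_tableaux N D = {T \<in> semistandard D. \<forall>c\<in>D. T c < N}"

lemma finite_bounded_tableaux [simp]: "finite D \<Longrightarrow> finite (bounded_tableaux N D)"
  by (rule finite_subset[OF _ finite_PiE[of D "\<lambda>_. {..<N}"]])
     (auto simp: bounded_tableaux_def semistandard_def PiE_def)

lemma bounded_tableaux_restrict: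
  assumes "T \<in> bounded_tableaux M D" "E \<subseteq> D" "\<And>c. c \<in> E \<Longrightarrow> T c < N"
  shows "restrict T E \<in> bounded_tableaux N E"
  using assms unfolding bounded_tableaux_def semistandard_def by (simp add: subset_iff)

definition schur_poly :: "(nat \<Rightarrow> 'a::comm_semiring_1) \<Rightarrow> nat \<Rightarrow> (nat \<times> nat) set \<Rightarrow> 'a" where
  "schur_poly x N D = (\<Sum>T\<in>bounded_tableaux N D. \<Prod>c\<in>D. x (T c))"

text \<open>The row lengths of the subtableau of entries below \<open>N\<close>, defined by
  counting; that the counted cells start the row is a separate fact about tableaux.\<close>

definition small_rows :: "nat \<Rightarrow> nat \<Rightarrow> (nat \<Rightarrow> nat) \<Rightarrow> (nat \<times> nat \<Rightarrow> nat) \<Rightarrow> nat \<Rightarrow> nat" where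
  "small_rows N k m T = (\<lambda>i\<in>{..<k}. card {j. j < m i \<and> T (i, j) < N})"

text \<open>Rows increase weakly, so the entries below \<open>N\<close> form an initial segment of
  the row.\<close>

lemma small_rows_iff:
  assumes T: "T \<in> bounded_tableaux M (diagram k m)" and i: "i < k" and j: "j < m i"
  shows "T (i, j) < N \<longleftrightarrow> j < small_rows N k m T i"
proof -
  let ?S = "{j. j < m i \<and> T (i, j) < N}"
  have fin: "finite ?S" by simp
  have down: "j' \<in> ?S" if "j \<in> ?S" "j' \<le> j" for j j'
  proof (cases "j' = j")
    case False
    then have "T (i, j') \<le> T (i, j)"
      using T that i by (simp add: bounded_tableaux_def semistandard_def)
    then show ?thesis using that by simp
  qed (use that in simp)
  have "?S = {..<card ?S}"
  proof (cases "?S = {}")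
    case False
    have "?S = {..Max ?S}"
      using down[OF Max_in[OF fin False]] Max_ge[OF fin] by blast
    then show ?thesis by (metis card_atMost lessThan_Suc_atMost)
  next
    case True
    then show ?thesis by (metis card.empty lessThan_0)
  qed
  then have "j \<in> ?S \<longleftrightarrow> j < card ?S" by blast
  then show ?thesis using i j by (simp add: small_rows_def)
qed

lemma small_rows_le: "i < k \<Longrightarrow> small_rows N k m T i \<le> m i"
  using card_mono[of "{..<m i}" "{j. j < m i \<and> T (i, j) < N}"] by (auto simp: small_rows_def)

text \<open>Columns increase strictly and no entry exceeds \<open>N\<close>, so a cell containing
  \<open>N\<close> has no cell below it: the cells with entry \<open>N\<close> form a horizontal
  strip.\<close>

lemma small_rows_interlacing:
  assumes m: "decreasing_rows k m" and T: "T \<in> bounded_tableaux (Suc N) (diagram k m)"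
  shows "small_rows N k m T \<in> interlacing k m"
  unfolding interlacing_def
proof (rule PiE_I)
  fix i assume "i \<in> {..<k}"
  then have i: "i < k" by simp
  have "m (Suc i) \<le> small_rows N k m T i" if si: "Suc i < k"
  proof (rule ccontr)
    assume *: "\<not> m (Suc i) \<le> small_rows N k m T i"
    let ?j = "small_rows N k m T i"
    have "m (Suc i) \<le> m i" using m si by (simp add: decreasing_rows_def)
    then have j: "?j < m (Suc i)" "?j < m i" using * by auto
    then have "T (i, ?j) < T (Suc i, ?j)" "T (Suc i, ?j) < Suc N"
      using T si by (auto simp: bounded_tableaux_def semistandard_def)
    then show False using small_rows_iff[OF T i j(2), of N] by simp
  qed
  then show "small_rows N k m T i \<in> {(if Suc i < k then m (Suc i) else 0)..m i}"
    using small_rows_le[OF i] by simp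
qed (simp add: small_rows_def)

text \<open>Erasing the entries equal to \<open>N\<close> leaves a tableau of interlacing shape in
  the first \<open>N\<close> variables; filling the strip with \<open>N\<close> inverts this. Row
  \<open>j\<close> loses \<open>m j - f j\<close> cells, which accounts for the power of
  \<open>x N\<close>.\<close>

lemma schur_poly_Suc:
  assumes m: "decreasing_rows k m"
  shows "schur_poly x (Suc N) (diagram k m) =
    (\<Sum>f\<in>interlacing k m. (\<Prod>j<k. x N ^ (m j - f j)) * schur_poly x N (diagram k f))"
proof -
  let ?tab = "\<lambda>N m. bounded_tableaux N (diagram k m)"
  let ?ext = "\<lambda>(f, T). \<lambda>c\<in>diagram k m. if c \<in> diagram k f then T c else N"
  let ?cut = "\<lambda>T. (small_rows N k m T, restrict T (diagram k (small_rows N k m T)))"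
  have sub: "diagram k f \<subseteq> diagram k m" if "f \<in> interlacing k m" for f
    using interlacing_le[OF that] by clarsimp (meson less_le_trans)
  have "schur_poly x (Suc N) (diagram k m) =
    (\<Sum>(f, T)\<in>(SIGMA f:interlacing k m. ?tab N f). (\<Prod>j<k. x N ^ (m j - f j)) * (\<Prod>c\<in>diagram k f. x (T c)))"
    unfolding schur_poly_def
  proof (rule sum.reindex_bij_witness[of _ ?ext ?cut])
    fix T assume T: "T \<in> ?tab (Suc N) m"
    let ?f = "small_rows N k m T"
    have f: "?f \<in> interlacing k m" using small_rows_interlacing[OF m T] .
    have eqN: "T (i, j) = N" if "i < k" "j < m i" "\<not> j < ?f i" for i j
    proof -
      have "T (i, j) < Suc N" using T that by (simp add: bounded_tableaux_def)
      then show ?thesis using small_rows_iff[OF T that(1,2), of N] that(3) by simp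
    qed
    show "?ext (?cut T) = T"
      using T eqN by (auto simp: fun_eq_iff bounded_tableaux_def semistandard_def extensional_def)
    show "?cut T \<in> (SIGMA f:interlacing k m. ?tab N f)"
    proof -
      have "T c < N" if "c \<in> diagram k ?f" for c
      proof (cases c)
        case (Pair i j)
        then have "i < k" "j < ?f i" "j < m i" using that subsetD[OF sub[OF f], of c] by auto
        then show ?thesis using small_rows_iff[OF T, of i j N] Pair by simp
      qed
      then have "restrict T (diagram k ?f) \<in> ?tab N ?f"
        by (rule bounded_tableaux_restrict[OF T sub[OF f]])
      then show ?thesis using f by simp
    qed
    have split: "diagram k m = diagram k ?f \<union> (SIGMA i:{..<k}. {?f i..<m i})"
      using sub[OF f] by (auto simp: diagram_def)
    have "(\<Prod>c\<in>diagram k m. x (T c)) =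
        (\<Prod>c\<in>diagram k ?f. x (T c)) * (\<Prod>c\<in>(SIGMA i:{..<k}. {?f i..<m i}). x (T c))"
      by (subst split, rule prod.union_disjoint) (auto simp: diagram_def)
    also have "(\<Prod>c\<in>(SIGMA i:{..<k}. {?f i..<m i}). x (T c)) = (\<Prod>c\<in>(SIGMA i:{..<k}. {?f i..<m i}). x N)"
      using eqN by (intro prod.cong) auto
    also have "\<dots> = (\<Prod>j<k. x N ^ (m j - ?f j))"
      by (simp add: power_sum)
    finally show "(case ?cut T of (f, T) \<Rightarrow> (\<Prod>j<k. x N ^ (m j - f j)) * (\<Prod>c\<in>diagram k f. x (T c))) =
      (\<Prod>c\<in>diagram k m. x (T c))"
      by (simp add: mult.commute)
  next
    fix fT assume "fT \<in> (SIGMA f:interlacing k m. ?tab N f)"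
    then obtain f T where fT: "fT = (f, T)" and f: "f \<in> interlacing k m" and T: "T \<in> ?tab N f" by auto
    let ?T = "?ext (f, T)"
    have le: "f i \<le> m i" if "i < k" for i using interlacing_le[OF f that] .
    have ge: "m j \<le> f i" if "i < j" "j < k" for i j using interlacing_ge[OF m f that] .
    have T': "?T \<in> ?tab (Suc N) m"
      unfolding bounded_tableaux_def semistandard_def
    proof (intro CollectI conjI allI impI ballI)
      show "?T \<in> extensional (diagram k m)" by simp
      show "?T c < Suc N" if "c \<in> diagram k m" for c
        using that T by (auto simp: bounded_tableaux_def less_Suc_eq)
      show "?T (i, j) \<le> ?T (i, j')"
        if "(i, j) \<in> diagram k m \<and> (i, j') \<in> diagram k m \<and> j < j'" for i j j'
        using that T by (auto simp: bounded_tableaux_def semistandard_def intro: less_imp_le)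
      fix i i' j
      assume *: "(i, j) \<in> diagram k m \<and> (i', j) \<in> diagram k m \<and> i < i'"
      \<comment> \<open>Interlacing puts the upper cell inside the smaller shape, so its entry comes
        from \<open>T\<close> and is below \<open>N\<close>, whether or not the lower cell was newly
        filled.\<close>
      then have "j < f i" using ge[of i i'] by auto
      then show "?T (i, j) < ?T (i', j)"
        using * T by (auto simp: bounded_tableaux_def semistandard_def)
    qed
    then show "?ext fT \<in> ?tab (Suc N) m" using fT by simp
    have "card {j. j < m i \<and> ?T (i, j) < N} = f i" if i: "i < k" for i
    proof -
      have "{j. j < m i \<and> ?T (i, j) < N} = {..<f i}"
        using T i le[OF i] by (auto simp: bounded_tableaux_def split: if_splits)
      then show ?thesis by simp
    qed
    then have rows: "small_rows N k m ?T = f"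
      using f by (auto simp: small_rows_def fun_eq_iff interlacing_def PiE_def extensional_def)
    have TE: "T \<in> extensional (diagram k f)"
      using T by (simp add: bounded_tableaux_def semistandard_def)
    have "restrict ?T (diagram k f) = T"
    proof
      fix c
      show "restrict ?T (diagram k f) c = T c"
        using subsetD[OF sub[OF f], of c] extensional_arb[OF TE, of c]
        by (cases "c \<in> diagram k f") simp_all
    qed
    then show "?cut (?ext fT) = fT" unfolding fT by (simp only: rows)
  qed
  also have "\<dots> = (\<Sum>f\<in>interlacing k m. (\<Prod>j<k. x N ^ (m j - f j)) * schur_poly x N (diagram k f))"
    unfolding schur_poly_def by (subst sum.Sigma[symmetric]) (auto simp: sum_distrib_left)
  finally show ?thesis .
qed

text \<open>Both sides obey the same recursion in the number of variables and agree when there are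
  none. The shape varies in the induction, and interlacing shapes are again decreasing.\<close>

theorem schur_poly_eq_jacobi_trudi:
  fixes x :: "nat \<Rightarrow> 'a::comm_ring_1"
  assumes "decreasing_rows k m"
  shows "schur_poly x N (diagram k m) = jacobi_trudi x N k m"
  using assms
proof (induction N arbitrary: m)
  case 0
  show ?case
  proof (cases "\<forall>j<k. m j = 0")
    case True
    then have "diagram k m = {}" by (auto simp: diagram_def)
    then have "bounded_tableaux 0 (diagram k m) = {\<lambda>_. undefined}" "diagram k m = {}"
      by (auto simp: bounded_tableaux_def semistandard_def)
    then show ?thesis using True jacobi_trudi_0[OF 0, of x] by (simp add: schur_poly_def)
  next
    case False
    then have "diagram k m \<noteq> {}" by (auto simp: diagram_def)
    then have "bounded_tableaux 0 (diagram k m) = {}"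
      by (auto simp: bounded_tableaux_def)
    then show ?thesis using False jacobi_trudi_0[OF 0, of x] by (auto simp: schur_poly_def)
  qed
next
  case (Suc N)
  then show ?case
    by (simp add: schur_poly_Suc jacobi_trudi_Suc interlacing_decreasing)
qed

section \<open>Distinct partitions by alternating sum\<close>

text \<open>The Gaussian binomial coefficient \<open>[a + b choose a]\<close> in \<open>Q\<close>.\<close>

fun box_poly :: "'a::comm_ring_1 \<Rightarrow> nat \<Rightarrow> nat \<Rightarrow> 'a" where
  "box_poly Q 0 b = 1"
| "box_poly Q (Suc a) 0 = 1"
| "box_poly Q (Suc a) (Suc b) = box_poly Q a (Suc b) + Q ^ Suc a * box_poly Q (Suc a) b"

lemma box_poly_0_right [simp]: "box_poly Q a 0 = 1"
  by (cases a) auto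

text \<open>The quotient of neighbouring Gaussian binomials with denominators cleared, which avoids
  division in the ring. The proof is a double induction with the defining q-Pascal rule.\<close>

lemma box_poly_ratio:
  "(1 - Q ^ Suc b) * box_poly Q a (Suc b) = (1 - Q ^ Suc a) * box_poly Q (Suc a) b"
proof (induction a arbitrary: b)
  case 0
  show ?case by (induction b) (simp_all add: algebra_simps)
next
  case (Suc a)
  note IH = Suc.IH
  show ?case
  proof (induction b)
    case 0
    show ?case using Suc.IH[of 0] by (simp add: distrib_left) (simp add: algebra_simps)
  next
    case (Suc b)
    have "(1 - Q ^ Suc (Suc b)) * box_poly Q (Suc a) (Suc (Suc b)) =
        (1 - Q ^ Suc (Suc b)) * box_poly Q a (Suc (Suc b))
        + (1 - Q ^ Suc (Suc b)) * Q ^ Suc a * box_poly Q (Suc a) (Suc b)"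
      by (simp only: box_poly.simps distrib_left mult.assoc)
    \<comment> \<open>Both sides of the claim equal this multiple of the middle coefficient. The
      hypothesis in \<open>a\<close> leads here from the left; splitting the factor differently lets
      the hypothesis in \<open>b\<close> finish.\<close>
    also have "\<dots> = (1 - Q ^ Suc (Suc a + Suc b)) * box_poly Q (Suc a) (Suc b)"
      by (simp only: IH)
         (simp add: algebra_simps power_add)
    also have "\<dots> = (1 - Q ^ Suc (Suc a)) * box_poly Q (Suc a) (Suc b)
        + Q ^ Suc (Suc a) * ((1 - Q ^ Suc b) * box_poly Q (Suc a) (Suc b))"
      by (simp add: algebra_simps power_add)
    also have "\<dots> = (1 - Q ^ Suc (Suc a)) * box_poly Q (Suc a) (Suc b)
        + Q ^ Suc (Suc a) * ((1 - Q ^ Suc (Suc a)) * box_poly Q (Suc (Suc a)) b)"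
      by (simp only: Suc.IH)
    also have "\<dots> = (1 - Q ^ Suc (Suc a)) * box_poly Q (Suc (Suc a)) (Suc b)"
      by (simp only: box_poly.simps(3)[of Q "Suc a" b] distrib_left mult_ac)
    finally show ?case .
  qed
qed

text \<open>The second q-Pascal rule; its difference from the defining one is exactly
  \<open>box_poly_ratio\<close>.\<close>

lemma box_poly_Suc_Suc':
  "box_poly Q (Suc a) (Suc b) = box_poly Q (Suc a) b + Q ^ Suc b * box_poly Q a (Suc b)"
  using box_poly_ratio[of Q b a] by (simp add: algebra_simps)

text \<open>Exchanging the arguments turns one q-Pascal rule into the other.\<close>

lemma box_poly_commute: "box_poly Q a b = box_poly Q b a"
proof (induction "a + b" arbitrary: a b rule: less_induct)
  case less
  show ?case
  proof (cases a; cases b)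
    fix a' b' assume ab: "a = Suc a'" "b = Suc b'"
    have "box_poly Q (Suc a') (Suc b') = box_poly Q a' (Suc b') + Q ^ Suc a' * box_poly Q (Suc a') b'"
      by simp
    also have "\<dots> = box_poly Q (Suc b') a' + Q ^ Suc a' * box_poly Q b' (Suc a')"
      using less[of a' "Suc b'"] less[of "Suc a'" b'] ab by simp
    also have "\<dots> = box_poly Q (Suc b') (Suc a')"
      by (rule box_poly_Suc_Suc'[symmetric])
    finally show ?thesis using ab by simp
  qed auto
qed

text \<open>The principal specialization: the recursion on the last variable of a geometric
  progression becomes the q-Pascal rule after a power of \<open>z\<close> is taken out. The
  arguments \<open>a\<close>, \<open>b\<close> correspond to \<open>Suc a\<close> variables and
  degree \<open>b\<close>.\<close>

lemma complete_sym_geometric: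
  "complete_sym (\<lambda>i. z * Q ^ i) (Suc a) b = z ^ b * box_poly Q a b"
proof (induction a b rule: box_poly.induct[where ?a0.0 = Q])
  case (1 Q b)
  show ?case by (induction b) auto
next
  case (3 Q a b)
  then show ?case
    by (subst complete_sym.simps(3)) (simp only: box_poly.simps, simp add: algebra_simps)
qed auto

section \<open>Alternating sums of sets of distinct parts\<close>

definition alternating_sum :: "nat set \<Rightarrow> int" where
  "alternating_sum D = alt_sum (rev (sorted_list_of_set D))"

lemma alternating_sum_empty [simp]: "alternating_sum {} = 0"
  by (simp add: alternating_sum_def)

text \<open>The new largest part comes first in decreasing order and flips every later sign.\<close>

lemma alternating_sum_insert:
  assumes "D \<subseteq> {1..N}"
  shows "alternating_sum (insert (Suc N) D) = int (Suc N) - alternating_sum D"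
proof -
  have fin: "finite D" using assms finite_subset by blast
  have "sorted_list_of_set (insert (Suc N) D) = sorted_list_of_set D @ [Suc N]"
  proof (rule sorted_distinct_set_unique)
    show "sorted (sorted_list_of_set D @ [Suc N])"
      using assms fin by (auto simp: sorted_append)
    show "distinct (sorted_list_of_set D @ [Suc N])" using assms fin by auto
  qed (use fin in \<open>auto simp del: sorted_list_of_set_insert_remove\<close>)
  then show ?thesis by (simp add: alternating_sum_def)
qed

lemma Pow_atLeastAtMost_Suc:
  "Pow {1..Suc N} = Pow {1..N} \<union> insert (Suc N) ` Pow {1..N}"
  by (simp add: atLeastAtMostSuc_conv Pow_insert)

text \<open>Adding the part \<open>Suc N\<close> sends a value \<open>r\<close> to
  \<open>Suc N - r\<close>, which maps the range \<open>0..N\<close> to \<open>1..Suc N\<close>, so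
  the bounds propagate.\<close>

lemma alternating_sum_bounds:
  "D \<subseteq> {1..N} \<Longrightarrow> 0 \<le> alternating_sum D \<and> alternating_sum D \<le> int N"
proof (induction N arbitrary: D)
  case (Suc N)
  then have "D \<in> Pow {1..N} \<union> insert (Suc N) ` Pow {1..N}"
    using Pow_atLeastAtMost_Suc by blast
  then show ?case
  proof
    assume "D \<in> insert (Suc N) ` Pow {1..N}"
    then obtain E where "E \<subseteq> {1..N}" "D = insert (Suc N) E" by auto
    then show ?thesis using Suc.IH[of E] alternating_sum_insert[of E N] by simp
  qed (use Suc.IH[of D] in auto)
qed auto

definition distinct_gf :: "nat \<Rightarrow> int \<Rightarrow> int fps" where
  "distinct_gf N r = (\<Sum>D | D \<subseteq> {1..N} \<and> alternating_sum D = r. fps_X ^ \<Sum>D)"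

lemma distinct_gf_out_of_range: "r < 0 \<or> int N < r \<Longrightarrow> distinct_gf N r = 0"
  unfolding distinct_gf_def using alternating_sum_bounds[of _ N]
  by (intro sum.neutral) (metis (mono_tags, lifting) linorder_not_less mem_Collect_eq)

lemma distinct_gf_Suc:
  "distinct_gf (Suc N) r = distinct_gf N r + fps_X ^ Suc N * distinct_gf N (int (Suc N) - r)"
proof -
  let ?S = "\<lambda>N r. {D. D \<subseteq> {1..N} \<and> alternating_sum D = r}"
  have fin: "finite (?S N r)" for N r
    by (rule finite_subset[of _ "Pow {1..N}"]) auto
  have notin: "Suc N \<notin> D" if "D \<subseteq> {1..N}" for D using that by auto
  have "?S (Suc N) r = {D \<in> Pow {1..N} \<union> insert (Suc N) ` Pow {1..N}. alternating_sum D = r}"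
    using Pow_atLeastAtMost_Suc[of N] by auto
  also have "\<dots> = ?S N r \<union> insert (Suc N) ` ?S N (int (Suc N) - r)"
    by (auto simp: alternating_sum_insert)
  finally have split: "?S (Suc N) r = ?S N r \<union> insert (Suc N) ` ?S N (int (Suc N) - r)" .
  have inj: "inj_on (insert (Suc N)) (?S N (int (Suc N) - r))"
    using notin by (intro inj_onI) (metis (mono_tags, lifting) insert_ident mem_Collect_eq)
  have "distinct_gf (Suc N) r = distinct_gf N r +
      (\<Sum>D\<in>insert (Suc N) ` ?S N (int (Suc N) - r). fps_X ^ \<Sum>D)"
    unfolding distinct_gf_def split using notin fin by (intro sum.union_disjoint) auto
  also have "(\<Sum>D\<in>insert (Suc N) ` ?S N (int (Suc N) - r). (fps_X :: int fps) ^ \<Sum>D) =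
      (\<Sum>D\<in>?S N (int (Suc N) - r). fps_X ^ Suc N * fps_X ^ \<Sum>D)"
    unfolding sum.reindex[OF inj] o_def
  proof (rule sum.cong[OF refl])
    fix D assume "D \<in> ?S N (int (Suc N) - r)"
    then have "Suc N \<notin> D" "finite D" using notin finite_subset by auto
    then show "(fps_X :: int fps) ^ \<Sum>(insert (Suc N) D) = fps_X ^ Suc N * fps_X ^ \<Sum>D"
      by (simp add: power_add)
  qed
  also have "\<dots> = fps_X ^ Suc N * distinct_gf N (int (Suc N) - r)"
    by (simp add: distinct_gf_def sum_distrib_left)
  finally show ?thesis .
qed

text \<open>Deleting the part \<open>N + 1\<close> reflects the alternating sum, so the two terms of
  the recursion are, up to the symmetry of Gaussian binomials, those of the \<open>q\<close>-Pascal rule.\<close>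

lemma distinct_gf_eq:
  "b \<le> N \<Longrightarrow> distinct_gf N (int b) = fps_X ^ b * box_poly (fps_X\<^sup>2) (N - b) b"
proof (induction N arbitrary: b)
  case 0
  have "{D. D = {} \<and> alternating_sum D = 0} = {{}}" by auto
  with 0 show ?case by (simp add: distinct_gf_def)
next
  case (Suc N)
  consider "b = 0" | "b = Suc N" | c M where "b = Suc c" "N = M + Suc c"
    using Suc.prems by (metis le_Suc_eq le_add_diff_inverse2 not0_implies_Suc)
  then show ?case
  proof cases
    \<comment> \<open>At either end of the range, one term of the recursion asks for an impossible
      alternating sum and drops out.\<close>
    case 1
    then show ?thesis
      using Suc.IH[of 0] by (simp add: distinct_gf_Suc distinct_gf_out_of_range)
  next
    case 2
    then show ?thesis
      using Suc.IH[of 0] by (simp add: distinct_gf_Suc distinct_gf_out_of_range)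
  next
    case 3
    have "int (Suc N) - int b = int (Suc M)" using 3 by simp
    then have "distinct_gf (Suc N) (int b) =
      fps_X ^ Suc c * box_poly (fps_X\<^sup>2) M (Suc c) +
      fps_X ^ (Suc N + Suc M) * box_poly (fps_X\<^sup>2) c (Suc M)"
      using Suc.IH[of b] Suc.IH[of "Suc M"] 3 by (simp only: distinct_gf_Suc) (simp add: power_add mult.assoc)
    \<comment> \<open>As \<open>N = M + b\<close>, the exponent is \<open>b + 2 * (M + 1)\<close>:
      the common power \<open>fps_X ^ b\<close> times the weight in the q-Pascal rule.\<close>
    also have "fps_X ^ (Suc N + Suc M) = (fps_X ^ Suc c * (fps_X\<^sup>2) ^ Suc M :: int fps)"
      using 3 by (simp flip: power_mult power_add)
    finally show ?thesis
      using 3 by (simp add: box_poly_commute[of _ c "Suc M"] Suc_diff_le distrib_left mult.assoc)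
  qed
qed

definition distinct_parts :: "int \<Rightarrow> nat \<Rightarrow> nat set set" where
  "distinct_parts r u = {D. finite D \<and> 0 \<notin> D \<and> alternating_sum D = r \<and> \<Sum>D = u}"

lemma distinct_parts_subset:
  assumes "D \<in> distinct_parts r u" "u \<le> N"
  shows "D \<subseteq> {1..N}"
proof
  fix p assume p: "p \<in> D"
  then have "p \<le> u" using assms(1) member_le_sum[of p D "\<lambda>x. x"] by (auto simp: distinct_parts_def)
  moreover have "p \<noteq> 0" using p assms(1) by (cases "p = 0") (simp_all add: distinct_parts_def)
  ultimately show "p \<in> {1..N}" using assms(2) by simp
qed

lemma finite_distinct_parts [simp]: "finite (distinct_parts r u)"
proof (rule finite_subset)
  show "distinct_parts r u \<subseteq> Pow {1..u}" using distinct_parts_subset by blast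
qed simp

text \<open>A set of positive parts with sum \<open>u\<close> has no part above \<open>u\<close>, so
  every bound \<open>N \<ge> u\<close> gives the same coefficient.\<close>

lemma card_distinct_parts_eq_distinct_gf:
  assumes "u \<le> N"
  shows "int (card (distinct_parts r u)) = distinct_gf N r $ u"
proof -
  let ?S = "{D. D \<subseteq> {1..N} \<and> alternating_sum D = r}"
  have fin: "finite ?S" by (rule finite_subset[of _ "Pow {1..N}"]) auto
  have "distinct_gf N r $ u = (\<Sum>D\<in>?S. if \<Sum>D = u then 1 else 0)"
    unfolding distinct_gf_def fps_sum_nth by (intro sum.cong) auto
  also have "\<dots> = int (card {D \<in> ?S. \<Sum>D = u})"
    using fin by (simp flip: sum.inter_filter)
  also have "{D \<in> ?S. \<Sum>D = u} = distinct_parts r u"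
  proof (intro equalityI subsetI)
    fix D assume "D \<in> {D \<in> ?S. \<Sum>D = u}"
    moreover from this have "finite D" using finite_subset[of D "{1..N}"] by simp
    ultimately show "D \<in> distinct_parts r u" by (auto simp: distinct_parts_def)
  next
    fix D assume "D \<in> distinct_parts r u"
    then show "D \<in> {D \<in> ?S. \<Sum>D = u}"
      using distinct_parts_subset[OF _ assms, of D r] by (simp add: distinct_parts_def)
  qed
  finally show ?thesis by simp
qed

text \<open>Variable \<open>x i\<close> is divisible by \<open>X ^ (i + 1)\<close>, so variables
  from index \<open>u\<close> on cannot reach degree \<open>u\<close>.\<close>

lemma complete_sym_nth_stable:
  fixes x :: "nat \<Rightarrow> 'a::comm_ring_1 fps"
  assumes x: "\<And>i t. t \<le> i \<Longrightarrow> x i $ t = 0" and "u \<le> M" "M \<le> N"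
  shows "complete_sym x N a $ u = complete_sym x M a $ u"
  using assms(3)
proof (induction N rule: dec_induct)
  case (step N)
  then show ?case using x[of _ N] assms(2) by (cases a) (simp_all add: fps_mult_nth)
qed simp

lemma card_distinct_parts:
  assumes "u \<le> N"
  shows "int (card (distinct_parts r u)) = complete_sym_int (\<lambda>i. fps_X ^ (2 * i + 1)) N r $ u"
proof (cases "r < 0")
  case True
  then show ?thesis
    by (subst card_distinct_parts_eq_distinct_gf[OF order_refl])
       (simp add: distinct_gf_out_of_range complete_sym_int_def)
next
  case False
  then obtain b where b: "r = int b" by (metis nonneg_int_cases not_less)
  have alphabet: "(\<lambda>i. fps_X ^ (2 * i + 1)) = (\<lambda>i. fps_X * (fps_X\<^sup>2) ^ i :: int fps)"
    by (simp flip: power_mult)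
  \<comment> \<open>The bound \<open>b + u\<close> on the parts turns the Gaussian binomial into one
    with first argument \<open>u\<close>, hence \<open>Suc u\<close> variables; stability then
    adjusts their number.\<close>
  have "int (card (distinct_parts r u)) = distinct_gf (b + u) (int b) $ u"
    unfolding b by (rule card_distinct_parts_eq_distinct_gf) simp
  also have "\<dots> = complete_sym (\<lambda>i. fps_X ^ (2 * i + 1)) (Suc u) b $ u"
    unfolding alphabet complete_sym_geometric by (simp add: distinct_gf_eq)
  also have "\<dots> = complete_sym (\<lambda>i. fps_X ^ (2 * i + 1)) u b $ u"
    by (rule complete_sym_nth_stable) auto
  also have "\<dots> = complete_sym (\<lambda>i. fps_X ^ (2 * i + 1)) N b $ u"
    using assms by (intro complete_sym_nth_stable[symmetric]) auto
  finally show ?thesis using b by (simp add: complete_sym_int_def)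
qed

section \<open>Partitions by largest part\<close>

definition max_part :: "nat multiset \<Rightarrow> nat" where
  "max_part \<alpha> = Max (insert 0 (set_mset \<alpha>))"

lemma max_part_eq_0_iff: "max_part \<alpha> = 0 \<longleftrightarrow> (\<forall>p\<in>#\<alpha>. p = 0)"
  by (auto simp: max_part_def Max_eq_iff)

lemma max_part_add_0 [simp]: "max_part (add_mset 0 \<alpha>) = max_part \<alpha>"
  by (simp add: max_part_def)

lemma max_part_image_Suc: "\<alpha> \<noteq> {#} \<Longrightarrow> max_part (image_mset Suc \<alpha>) = Suc (max_part \<alpha>)"
  by (simp add: max_part_def flip: mono_Max_commute[OF mono_Suc])

text \<open>Partitions with at most \<open>N\<close> parts, padded by zeros to exactly
  \<open>N\<close>, and weighted as two copies. With the size fixed, lowering every part by one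
  removes a fixed weight.\<close>

definition padded_parts :: "nat \<Rightarrow> nat \<Rightarrow> nat \<Rightarrow> nat multiset set" where
  "padded_parts N a t = {\<alpha>. size \<alpha> = N \<and> max_part \<alpha> = a \<and> \<Sum>\<^sub># (\<alpha> + \<alpha>) = t}"

lemma sum_mset_image_Suc: "\<Sum>\<^sub># (image_mset Suc \<alpha>) = \<Sum>\<^sub># \<alpha> + size \<alpha>"
  by (induction \<alpha>) auto

lemma padded_parts_Suc_Suc:
  "padded_parts (Suc N) (Suc a) t = add_mset 0 ` padded_parts N (Suc a) t \<union>
    (if t < 2 * N + 2 then {} else image_mset Suc ` padded_parts (Suc N) a (t - (2 * N + 2)))"
  (is "_ = ?A \<union> ?B")
proof (intro equalityI subsetI)
  fix \<alpha> assume \<alpha>: "\<alpha> \<in> padded_parts (Suc N) (Suc a) t"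
  show "\<alpha> \<in> ?A \<union> ?B"
  proof (cases "0 \<in># \<alpha>")
    case True
    then obtain \<beta> where "\<alpha> = add_mset 0 \<beta>" by (metis multi_member_split)
    then show ?thesis using \<alpha> by (auto simp: padded_parts_def)
  next
    case False
    let ?\<beta> = "image_mset (\<lambda>p. p - 1) \<alpha>"
    have "image_mset Suc ?\<beta> = image_mset (\<lambda>p. p) \<alpha>"
      unfolding image_mset.compositionality o_def
      using False by (intro image_mset_cong) (metis Suc_pred' bot_nat_0.not_eq_extremum diff_Suc_1' diff_self_eq_0 One_nat_def)
    then have eq: "image_mset Suc ?\<beta> = \<alpha>" by simp
    have sz: "size ?\<beta> = Suc N" using \<alpha> by (simp add: padded_parts_def)
    then have "?\<beta> \<noteq> {#}" by (metis nat.distinct(1) size_empty)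
    then have "max_part \<alpha> = Suc (max_part ?\<beta>)" using max_part_image_Suc eq by metis
    moreover have "\<Sum>\<^sub># \<alpha> = \<Sum>\<^sub># ?\<beta> + Suc N" using sum_mset_image_Suc[of ?\<beta>] eq sz by simp
    ultimately have \<beta>: "?\<beta> \<in> padded_parts (Suc N) a (t - (2 * N + 2))" and t: "\<not> t < 2 * N + 2"
      using \<alpha> sz by (auto simp: padded_parts_def)
    have "\<alpha> \<in> image_mset Suc ` padded_parts (Suc N) a (t - (2 * N + 2))"
      using \<beta> eq[symmetric] by (rule image_eqI[rotated])
    then show ?thesis using t by simp
  qed
next
  fix \<alpha> assume "\<alpha> \<in> ?A \<union> ?B"
  then show "\<alpha> \<in> padded_parts (Suc N) (Suc a) t"
  proof
    assume "\<alpha> \<in> ?B"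
    then obtain \<beta> where "\<not> t < 2 * N + 2" "\<beta> \<in> padded_parts (Suc N) a (t - (2 * N + 2))"
      "\<alpha> = image_mset Suc \<beta>" by (auto split: if_splits)
    moreover from this have "\<beta> \<noteq> {#}" by (auto simp: padded_parts_def)
    ultimately show ?thesis by (auto simp: padded_parts_def max_part_image_Suc sum_mset_image_Suc)
  qed (auto simp: padded_parts_def)
qed

text \<open>Conjugation in disguise: stripping a zero part or lowering all parts by one obeys the
  recursion of the complete symmetric polynomials.\<close>

lemma card_padded_parts:
  "finite (padded_parts N a t) \<and>
   int (card (padded_parts N a t)) = complete_sym (\<lambda>i. fps_X ^ (2 * i + 2)) N a $ t"
proof (induction "\<lambda>i. fps_X ^ (2 * i + 2) :: int fps" N a arbitrary: t rule: complete_sym.induct)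
  case (1 N)
  have "padded_parts N 0 t = (if t = 0 then {replicate_mset N 0} else {})"
  proof -
    have "\<alpha> = replicate_mset N 0" if "size \<alpha> = N" "max_part \<alpha> = 0" for \<alpha>
      using that set_mset_subset_singletonD[of \<alpha> 0] by (auto simp: max_part_eq_0_iff)
    moreover have "max_part (replicate_mset N 0) = 0"
      by (simp add: max_part_eq_0_iff)
    ultimately have "\<alpha> \<in> padded_parts N 0 t \<longleftrightarrow> \<alpha> = replicate_mset N 0 \<and> t = 0" for \<alpha>
      unfolding padded_parts_def by (cases "\<alpha> = replicate_mset N 0") auto
    then show ?thesis by auto
  qed
  then show ?case by simp
next
  case (2 a)
  have "padded_parts 0 (Suc a) t = {}" by (auto simp: padded_parts_def max_part_def)
  then show ?case by simp
next
  case (3 N a)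
  let ?x = "\<lambda>i. fps_X ^ (2 * i + 2) :: int fps"
  let ?A = "add_mset 0 ` padded_parts N (Suc a) t"
  let ?B = "if t < 2 * N + 2 then {} else image_mset Suc ` padded_parts (Suc N) a (t - (2 * N + 2))"
  have fin: "finite ?A" "finite ?B" using 3 by auto
  have "0 \<in># \<alpha>" if "\<alpha> \<in> ?A" for \<alpha> using that by auto
  moreover have "0 \<notin># \<alpha>" if "\<alpha> \<in> ?B" for \<alpha> using that by (auto split: if_splits)
  ultimately have disj: "?A \<inter> ?B = {}" by blast
  have "card ?A = card (padded_parts N (Suc a) t)"
    by (intro card_image inj_onI) simp
  moreover have "card (image_mset Suc ` S) = card S" for S
    by (rule card_image) (rule inj_on_subset[OF multiset.inj_map[OF inj_Suc] subset_UNIV])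
  then have "card ?B = (if t < 2 * N + 2 then 0 else card (padded_parts (Suc N) a (t - (2 * N + 2))))"
    by simp
  moreover have "card (padded_parts (Suc N) (Suc a) t) = card ?A + card ?B"
    unfolding padded_parts_Suc_Suc using fin disj by (rule card_Un_disjoint)
  moreover have "(?x N * complete_sym ?x (Suc N) a) $ t =
    (if t < 2 * N + 2 then 0 else complete_sym ?x (Suc N) a $ (t - (2 * N + 2)))"
    by (simp only: fps_X_power_mult_nth)
  ultimately have "int (card (padded_parts (Suc N) (Suc a) t)) = complete_sym ?x (Suc N) (Suc a) $ t"
    using 3 by (simp del: power_Suc)
  moreover have "finite (padded_parts (Suc N) (Suc a) t)"
    unfolding padded_parts_Suc_Suc using fin by simp
  ultimately show ?case by simp
qed

definition paired_parts :: "int \<Rightarrow> nat \<Rightarrow> nat multiset set" where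
  "paired_parts r t = {\<alpha>. 0 \<notin># \<alpha> \<and> int (max_part \<alpha>) = r \<and> \<Sum>\<^sub># (\<alpha> + \<alpha>) = t}"

lemma size_le_sum_mset: "0 \<notin># \<alpha> \<Longrightarrow> size \<alpha> \<le> \<Sum>\<^sub># (\<alpha> :: nat multiset)"
  by (induction \<alpha>) auto

text \<open>Zeros are stripped and restored. The padding fits because positive parts are at most as
  many as their sum, hence at most \<open>t \<le> N\<close>.\<close>

lemma bij_betw_padded_parts:
  assumes "t \<le> N"
  shows "bij_betw (filter_mset (\<lambda>p. p \<noteq> 0)) (padded_parts N a t) (paired_parts (int a) t)"
proof (rule bij_betw_byWitness[where f' = "\<lambda>\<alpha>. \<alpha> + replicate_mset (N - size \<alpha>) 0"])
  have filt: "max_part (filter_mset (\<lambda>p. p \<noteq> 0) \<alpha>) = max_part \<alpha>"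
    "\<Sum>\<^sub># (filter_mset (\<lambda>p. p \<noteq> 0) \<alpha>) = \<Sum>\<^sub># \<alpha>" for \<alpha>
  proof -
    have "insert 0 (set_mset (filter_mset (\<lambda>p. p \<noteq> 0) \<alpha>)) = insert 0 (set_mset \<alpha>)" by auto
    then show "max_part (filter_mset (\<lambda>p. p \<noteq> 0) \<alpha>) = max_part \<alpha>" by (simp add: max_part_def)
    show "\<Sum>\<^sub># (filter_mset (\<lambda>p. p \<noteq> 0) \<alpha>) = \<Sum>\<^sub># \<alpha>" by (induction \<alpha>) auto
  qed
  have add: "max_part (\<alpha> + replicate_mset n 0) = max_part \<alpha>" for \<alpha> n
    by (induction n) auto
  show "\<forall>\<alpha>\<in>padded_parts N a t.
      filter_mset (\<lambda>p. p \<noteq> 0) \<alpha> + replicate_mset (N - size (filter_mset (\<lambda>p. p \<noteq> 0) \<alpha>)) 0 = \<alpha>"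
  proof
    fix \<alpha> assume "\<alpha> \<in> padded_parts N a t"
    then have "size \<alpha> = N" by (simp add: padded_parts_def)
    moreover have "size \<alpha> = size (filter_mset (\<lambda>p. p \<noteq> 0) \<alpha>) + size (filter_mset (\<lambda>p. \<not> p \<noteq> 0) \<alpha>)"
      using arg_cong[OF multiset_partition[of \<alpha> "\<lambda>p. p \<noteq> 0"], of size] by (simp only: size_union)
    moreover have zeros: "filter_mset (\<lambda>p. \<not> p \<noteq> 0) \<alpha> = replicate_mset (count \<alpha> 0) 0"
      using filter_eq_replicate_mset[of 0 \<alpha>] by simp
    ultimately have "count \<alpha> 0 = N - size (filter_mset (\<lambda>p. p \<noteq> 0) \<alpha>)"
      by simp
    with zeros have "filter_mset (\<lambda>p. \<not> p \<noteq> 0) \<alpha> =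
        replicate_mset (N - size (filter_mset (\<lambda>p. p \<noteq> 0) \<alpha>)) 0"
      by (simp only:)
    then show "filter_mset (\<lambda>p. p \<noteq> 0) \<alpha> + replicate_mset (N - size (filter_mset (\<lambda>p. p \<noteq> 0) \<alpha>)) 0 = \<alpha>"
      using multiset_partition[of \<alpha> "\<lambda>p. p \<noteq> 0"] by simp
  qed
  show "\<forall>\<alpha>\<in>paired_parts (int a) t.
      filter_mset (\<lambda>p. p \<noteq> 0) (\<alpha> + replicate_mset (N - size \<alpha>) 0) = \<alpha>"
  proof
    fix \<alpha> assume "\<alpha> \<in> paired_parts (int a) t"
    then have "0 \<notin># \<alpha>" by (simp add: paired_parts_def)
    then have "filter_mset (\<lambda>p. p \<noteq> 0) \<alpha> = \<alpha>"
      by (intro multiset_eqI) (auto simp: not_in_iff)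
    moreover have "filter_mset (\<lambda>p. p \<noteq> 0) (replicate_mset (N - size \<alpha>) (0 :: nat)) = {#}"
      by (intro multiset_eqI) simp
    ultimately show "filter_mset (\<lambda>p. p \<noteq> 0) (\<alpha> + replicate_mset (N - size \<alpha>) 0) = \<alpha>"
      by (simp only: filter_union_mset empty_neutral)
  qed
  show "filter_mset (\<lambda>p. p \<noteq> 0) ` padded_parts N a t \<subseteq> paired_parts (int a) t"
    by (auto simp: padded_parts_def paired_parts_def filt simp del: neq0_conv)
  show "(\<lambda>\<alpha>. \<alpha> + replicate_mset (N - size \<alpha>) 0) ` paired_parts (int a) t \<subseteq> padded_parts N a t"
  proof clarify
    fix \<alpha> assume \<alpha>: "\<alpha> \<in> paired_parts (int a) t"
    then have "size \<alpha> \<le> N" using size_le_sum_mset[of \<alpha>] assms by (auto simp: paired_parts_def)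
    then show "\<alpha> + replicate_mset (N - size \<alpha>) 0 \<in> padded_parts N a t"
      using \<alpha> by (auto simp: paired_parts_def padded_parts_def add)
  qed
qed

lemma card_paired_parts:
  assumes "t \<le> N"
  shows "finite (paired_parts r t) \<and>
    int (card (paired_parts r t)) = complete_sym_int (\<lambda>i. fps_X ^ (2 * i + 2)) N r $ t"
proof (cases "r < 0")
  case True
  then have "paired_parts r t = {}" by (auto simp: paired_parts_def)
  then show ?thesis using True by (simp add: complete_sym_int_def)
next
  case False
  then obtain a where a: "r = int a" by (metis nonneg_int_cases not_less)
  show ?thesis
    unfolding a bij_betw_same_card[OF bij_betw_padded_parts[OF assms], symmetric]
    using card_padded_parts[of N a t] bij_betw_finite[OF bij_betw_padded_parts[OF assms]]
    by (simp add: complete_sym_int_def)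
qed

section \<open>The generating function of the pairing rank\<close>

text \<open>The inverse of splitting multiplicities by parity: \<open>\<alpha>\<close> records half
  of each multiplicity, rounded down, and the finite set \<open>D\<close> the part sizes of odd
  multiplicity.\<close>

definition merge :: "nat multiset \<Rightarrow> nat set \<Rightarrow> nat list" where
  "merge \<alpha> D = rev (sorted_list_of_multiset (\<alpha> + \<alpha> + mset_set D))"

lemma mset_merge [simp]: "mset (merge \<alpha> D) = \<alpha> + \<alpha> + mset_set D"
  by (simp add: merge_def)

lemma count_merge:
  "finite D \<Longrightarrow> count_list (merge \<alpha> D) p = 2 * count \<alpha> p + (if p \<in> D then 1 else 0)"
  by (simp flip: count_mset add: count_mset_set')

lemma set_merge [simp]: "finite D \<Longrightarrow> set (merge \<alpha> D) = set_mset \<alpha> \<union> D"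
  by (simp flip: set_mset_mset)

text \<open>A multiplicity \<open>2 * count \<alpha> p\<close>, possibly increased by one, reaches
  two exactly when \<open>p\<close> occurs in \<open>\<alpha>\<close>.\<close>

lemma largest_repeated_merge:
  assumes "finite D"
  shows "largest_repeated (merge \<alpha> D) = max_part \<alpha>"
proof -
  have "{p \<in> set (merge \<alpha> D). 2 \<le> count_list (merge \<alpha> D) p} = set_mset \<alpha>"
    using assms by (auto simp: count_merge Suc_le_eq split: if_splits)
  then show ?thesis by (simp add: largest_repeated_def max_part_def)
qed

lemma odd_parts_merge: "finite D \<Longrightarrow> odd_parts (merge \<alpha> D) = D"
  by (auto simp: odd_parts_def count_merge)

lemma pairing_rank_merge:
  "finite D \<Longrightarrow> pairing_rank (merge \<alpha> D) = int (max_part \<alpha>) - alternating_sum D"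
  by (simp add: pairing_rank_def largest_repeated_merge odd_alt_sum_def odd_parts_merge
      alternating_sum_def)

lemma int_partition_merge:
  "finite D \<Longrightarrow> int_partition (merge \<alpha> D) \<longleftrightarrow> 0 \<notin># \<alpha> \<and> 0 \<notin> D"
  by (auto simp: int_partition_def merge_def sorted_wrt_rev intro: ccontr)

lemma sum_list_merge: "sum_list (merge \<alpha> D) = \<Sum>\<^sub># (\<alpha> + \<alpha>) + \<Sum>D"
  by (simp flip: sum_mset_sum_list add: sum_unfold_sum_mset)

lemma int_partition_eq_merge:
  assumes "int_partition \<mu>"
  obtains \<alpha> where "\<mu> = merge \<alpha> (odd_parts \<mu>)"
proof -
  define \<alpha> where "\<alpha> = Abs_multiset (\<lambda>p. count_list \<mu> p div 2)"
  have "finite {p. 0 < count_list \<mu> p div 2}"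
    by (rule finite_subset[of _ "set \<mu>"]) (auto intro: ccontr simp: count_list_0_iff)
  then have \<alpha>: "count \<alpha> p = count_list \<mu> p div 2" for p by (simp add: \<alpha>_def)
  have fin: "finite (odd_parts \<mu>)" by (simp add: odd_parts_def)
  have "mset \<mu> = \<alpha> + \<alpha> + mset_set (odd_parts \<mu>)"
  proof (rule multiset_eqI)
    fix p
    have "p \<in> odd_parts \<mu> \<longleftrightarrow> odd (count_list \<mu> p)"
      by (auto simp: odd_parts_def intro: ccontr)
    then show "count (mset \<mu>) p = count (\<alpha> + \<alpha> + mset_set (odd_parts \<mu>)) p"
      using fin by (simp add: \<alpha> count_mset count_mset_set' parity_cases) presburger
  qed
  moreover have "sorted (rev \<mu>)"
    using assms by (simp add: int_partition_def sorted_wrt_rev)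
  ultimately have "rev \<mu> = sorted_list_of_multiset (\<alpha> + \<alpha> + mset_set (odd_parts \<mu>))"
    by (metis mset_rev sorted_list_of_multiset_mset sorted_sort_id)
  then show ?thesis using that[of \<alpha>] by (simp add: merge_def rev_swap)
qed

text \<open>The set is recovered from the odd multiplicities; cancelling it leaves twice the
  multiset, which can be halved.\<close>

lemma inj_on_merge: "inj_on (\<lambda>(\<alpha>, D). merge \<alpha> D) (UNIV \<times> Collect finite)"
proof (rule inj_onI, clarify)
  fix \<alpha> D \<beta> E assume fin: "finite D" "finite E" and eq: "merge \<alpha> D = merge \<beta> E"
  then have DE: "D = E" using odd_parts_merge by metis
  have "\<alpha> + \<alpha> + mset_set D = \<beta> + \<beta> + mset_set D"
    using arg_cong[OF eq, of mset] DE by simp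
  then have "\<alpha> + \<alpha> = \<beta> + \<beta>" by simp
  then have "count (\<alpha> + \<alpha>) p = count (\<beta> + \<beta>) p" for p by simp
  then have "\<alpha> = \<beta>" by (intro multiset_eqI) (metis count_union mult_2 nat_mult_eq_cancel1 zero_less_numeral)
  then show "\<alpha> = \<beta> \<and> D = E" using DE by simp
qed

text \<open>Rank \<open>s2 - s1\<close> means that the largest part of \<open>\<alpha>\<close> is
  \<open>c - s1\<close> and the alternating sum is \<open>c - s2\<close> for a common
  \<open>c\<close>, which becomes the summation index of a matrix product. As the largest part is at
  most \<open>n\<close>, all such \<open>c\<close> lie below \<open>L\<close>.\<close>

lemma partitions_of_rank_eq:
  assumes "n + s1 < L"
  shows "{\<mu>. int_partition \<mu> \<and> sum_list \<mu> = n \<and> pairing_rank \<mu> = int s2 - int s1} =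
    (\<lambda>(\<alpha>, D). merge \<alpha> D) ` (\<Union>(c, t)\<in>{..<L} \<times> {0..n}.
      paired_parts (int c - int s1) t \<times> distinct_parts (int c - int s2) (n - t))"
    (is "?P = _ ` ?U")
proof (intro equalityI subsetI)
  fix \<mu> assume \<mu>: "\<mu> \<in> ?P"
  define D where "D = odd_parts \<mu>"
  obtain \<alpha> where eq: "\<mu> = merge \<alpha> D" using int_partition_eq_merge \<mu> D_def by auto
  have fin: "finite D" by (simp add: D_def odd_parts_def)
  define c where "c = max_part \<alpha> + s1"
  have ip: "0 \<notin># \<alpha>" "0 \<notin> D" using \<mu> eq int_partition_merge[OF fin] by auto
  have sm: "\<Sum>\<^sub># (\<alpha> + \<alpha>) + \<Sum>D = n" using \<mu> eq sum_list_merge by auto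
  have rk: "int (max_part \<alpha>) - alternating_sum D = int s2 - int s1"
    using \<mu> eq pairing_rank_merge[OF fin] by auto
  have "max_part \<alpha> \<le> \<Sum>\<^sub># \<alpha>"
    unfolding max_part_def by (auto dest: multi_member_split)
  then have "c < L" using sm assms by (simp add: c_def)
  moreover have "\<alpha> \<in> paired_parts (int c - int s1) (\<Sum>\<^sub># (\<alpha> + \<alpha>))"
    using ip by (simp add: paired_parts_def c_def)
  moreover have "D \<in> distinct_parts (int c - int s2) (n - \<Sum>\<^sub># (\<alpha> + \<alpha>))"
    using ip fin rk sm by (auto simp: distinct_parts_def c_def)
  ultimately have "(\<alpha>, D) \<in> ?U"
    using sm by (intro UN_I[of "(c, \<Sum>\<^sub># (\<alpha> + \<alpha>))"]) auto
  then show "\<mu> \<in> (\<lambda>(\<alpha>, D). merge \<alpha> D) ` ?U" using eq by force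
next
  fix \<mu> assume "\<mu> \<in> (\<lambda>(\<alpha>, D). merge \<alpha> D) ` ?U"
  then show "\<mu> \<in> ?P"
    by (auto simp: paired_parts_def distinct_parts_def int_partition_merge sum_list_merge
        pairing_rank_merge)
qed

text \<open>For fixed \<open>c\<close>, summing over the weight \<open>t\<close> of the paired parts
  gives a Cauchy product. In each summand \<open>s1\<close> enters only the first factor and
  \<open>s2\<close> only the second, so row and column of the Toeplitz matrix separate.\<close>

lemma pairing_rank_gf_nth:
  assumes "n + s1 < L" "n \<le> N"
  shows "pairing_rank_gf (int s2 - int s1) $ n =
    (\<Sum>c<L. complete_sym_int (\<lambda>i. fps_X ^ (2 * i + 2)) N (int c - int s1) *
            complete_sym_int (\<lambda>i. fps_X ^ (2 * i + 1)) N (int c - int s2)) $ n"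
proof -
  let ?F = "\<lambda>(c, t). paired_parts (int c - int s1) t \<times> distinct_parts (int c - int s2) (n - t)"
  let ?I = "{..<L} \<times> {0..n}"
  have "inj_on (\<lambda>(\<alpha>, D). merge \<alpha> D) (\<Union>(?F ` ?I))"
    by (rule inj_on_subset[OF inj_on_merge]) (auto simp: distinct_parts_def)
  then have "card {\<mu>. int_partition \<mu> \<and> sum_list \<mu> = n \<and> pairing_rank \<mu> = int s2 - int s1} =
      card (\<Union>(?F ` ?I))"
    unfolding partitions_of_rank_eq[OF assms(1)] by (rule card_image)
  also have "\<dots> = (\<Sum>z\<in>?I. card (?F z))"
  proof (rule card_UN_disjoint)
    show "\<forall>z\<in>?I. finite (?F z)" using card_paired_parts assms(2) by auto
    \<comment> \<open>The multiset determines both indices: its largest part gives \<open>c\<close>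
      and its doubled sum gives \<open>t\<close>.\<close>
    show "\<forall>z\<in>?I. \<forall>w\<in>?I. z \<noteq> w \<longrightarrow> ?F z \<inter> ?F w = {}"
      by (auto simp: paired_parts_def distinct_parts_def)
  qed simp
  finally have "pairing_rank_gf (int s2 - int s1) $ n = (\<Sum>z\<in>?I. int (card (?F z)))"
    by (simp add: pairing_rank_gf_def)
  also have "\<dots> = (\<Sum>(c, t)\<in>?I.
      complete_sym_int (\<lambda>i. fps_X ^ (2 * i + 2)) N (int c - int s1) $ t *
      complete_sym_int (\<lambda>i. fps_X ^ (2 * i + 1)) N (int c - int s2) $ (n - t))"
  proof (rule sum.cong[OF refl], clarsimp simp only: card_cartesian_product of_nat_mult prod.case)
    fix c t assume "t \<in> {0..n}"
    then have "t \<le> N" "n - t \<le> N" using assms(2) by auto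
    then show "int (card (paired_parts (int c - int s1) t)) * int (card (distinct_parts (int c - int s2) (n - t))) =
      complete_sym_int (\<lambda>i. fps_X ^ (2 * i + 2)) N (int c - int s1) $ t *
      complete_sym_int (\<lambda>i. fps_X ^ (2 * i + 1)) N (int c - int s2) $ (n - t)"
      using card_paired_parts card_distinct_parts by simp
  qed
  also have "\<dots> = (\<Sum>c<L. complete_sym_int (\<lambda>i. fps_X ^ (2 * i + 2)) N (int c - int s1) *
            complete_sym_int (\<lambda>i. fps_X ^ (2 * i + 1)) N (int c - int s2)) $ n"
    by (simp add: fps_sum_nth fps_mult_nth sum.cartesian_product)
  finally show ?thesis .
qed

section \<open>Coefficientwise comparison\<close>

text \<open>Congruence modulo \<open>X ^ (n + 1)\<close>. Unlike equality of the single coefficient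
  \<open>n\<close>, it is preserved by products and hence by determinants.\<close>

definition fps_agree :: "nat \<Rightarrow> 'a::comm_ring_1 fps \<Rightarrow> 'a fps \<Rightarrow> bool" where
  "fps_agree n f g \<longleftrightarrow> (\<forall>t\<le>n. f $ t = g $ t)"

lemma fps_agree_mult: "fps_agree n f f' \<Longrightarrow> fps_agree n g g' \<Longrightarrow> fps_agree n (f * g) (f' * g')"
  by (auto simp: fps_agree_def fps_mult_nth intro!: sum.cong)

lemma fps_agree_prod:
  "(\<And>a. a \<in> A \<Longrightarrow> fps_agree n (f a) (g a)) \<Longrightarrow> fps_agree n (\<Prod>a\<in>A. f a) (\<Prod>a\<in>A. g a)"
  by (induction A rule: infinite_finite_induct) (simp_all add: fps_agree_mult, simp_all add: fps_agree_def)

lemma fps_agree_sum: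
  "(\<And>a. a \<in> A \<Longrightarrow> fps_agree n (f a) (g a)) \<Longrightarrow> fps_agree n (\<Sum>a\<in>A. f a) (\<Sum>a\<in>A. g a)"
  by (auto simp: fps_agree_def fps_sum_nth intro!: sum.cong)

lemma fps_agree_det:
  assumes "\<And>i j. i < k \<Longrightarrow> j < k \<Longrightarrow> fps_agree n (A i j) (B i j)"
  shows "fps_agree n (det (mat k k (\<lambda>(i, j). A i j))) (det (mat k k (\<lambda>(i, j). B i j)))"
proof -
  have "p j < k" if "p permutes {0..<k}" "j < k" for p j
    using permutes_in_image[OF that(1), of j] that(2) by simp
  then show ?thesis
    unfolding det_mat_cols using assms
    by (intro fps_agree_sum fps_agree_mult fps_agree_prod) (auto simp: fps_agree_def)
qed

text \<open>Each factor without constant term raises the order by at least one.\<close>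

lemma fps_prod_nth_eq_0:
  fixes f :: "'b \<Rightarrow> 'a::comm_ring_1 fps"
  assumes "finite A" "\<And>a. a \<in> A \<Longrightarrow> f a $ 0 = 0" "n < card A"
  shows "(\<Prod>a\<in>A. f a) $ n = 0"
  using assms
proof (induction A arbitrary: n rule: finite_induct)
  case (insert a A)
  have "f a $ i * (\<Prod>a\<in>A. f a) $ (n - i) = 0" if "i \<le> n" for i
    using insert that by (cases "i = 0") auto
  then show ?case using insert.hyps by (simp add: fps_mult_nth)
qed simp

text \<open>In the coefficientwise topology it suffices that coefficient \<open>n\<close> of the
  partial sums is constant once they contain \<open>F n\<close>.\<close>

lemma fps_has_sumI:
  fixes f :: "'b \<Rightarrow> 'a::comm_ring_1 fps"
  assumes "\<And>n. finite (F n)" "\<And>n. F n \<subseteq> A"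
    and zero: "\<And>n a. a \<in> A \<Longrightarrow> a \<notin> F n \<Longrightarrow> f a $ n = 0"
    and sum: "\<And>n. S $ n = (\<Sum>a\<in>F n. f a $ n)"
  shows "(f has_sum S) A"
  unfolding has_sum_def
proof (rule tendsto_fpsI)
  fix n
  have "sum f Y $ n = S $ n" if "finite Y" "F n \<subseteq> Y" "Y \<subseteq> A" for Y
    unfolding fps_sum_nth sum using that zero by (intro sum.mono_neutral_right) auto
  then show "\<forall>\<^sub>F Y in finite_subsets_at_top A. sum f Y $ n = S $ n"
    unfolding eventually_finite_subsets_at_top using assms(1,2) by (intro exI[of _ "F n"]) simp
qed

section \<open>Schur functions as coefficientwise limits of Schur polynomials\<close>

definition row_length :: "nat list \<Rightarrow> nat \<Rightarrow> nat" where
  "row_length \<mu> i = (if i < length \<mu> then \<mu> ! i else 0)"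

lemma young_diagram_eq: "length \<mu> \<le> k \<Longrightarrow> young_diagram \<mu> = diagram k (row_length \<mu>)"
  by (auto simp: young_diagram_def diagram_def row_length_def split: if_splits)

lemma decreasing_rows_row_length: "int_partition \<mu> \<Longrightarrow> decreasing_rows k (row_length \<mu>)"
  unfolding decreasing_rows_def row_length_def int_partition_def
  by (auto simp: sorted_wrt_iff_nth_less le_less)

lemma schur_nth:
  fixes x :: "nat \<Rightarrow> 'a::comm_ring_1 fps"
  assumes x: "\<And>i t. t \<le> i \<Longrightarrow> x i $ t = 0" and fin: "finite (young_diagram \<mu>)" and "n \<le> N"
  shows "schur x \<mu> $ n = schur_poly x N (young_diagram \<mu>) $ n"
proof -
  let ?D = "young_diagram \<mu>"
  \<comment> \<open>Coefficient \<open>t\<close> needs only variables with index below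
    \<open>t\<close>; the maximum makes the number exactly \<open>N\<close> at every
    \<open>t \<le> N\<close>, in particular at \<open>n\<close>.\<close>
  let ?S = "Abs_fps (\<lambda>t. schur_poly x (max t N) ?D $ t)"
  have "((\<lambda>T. \<Prod>c\<in>?D. x (T c)) has_sum ?S) (ssyt \<mu>)"
  proof (rule fps_has_sumI[where F = "\<lambda>t. bounded_tableaux (max t N) ?D"])
    show "bounded_tableaux (max t N) ?D \<subseteq> ssyt \<mu>" for t
      by (auto simp: bounded_tableaux_def semistandard_def ssyt_def)
    fix t T assume "T \<in> ssyt \<mu>" "T \<notin> bounded_tableaux (max t N) ?D"
    then obtain c where c: "c \<in> ?D" "t \<le> T c"
      by (auto simp: bounded_tableaux_def semistandard_def ssyt_def not_less)
    \<comment> \<open>The entry \<open>T c \<ge> t\<close> gives a factor with no coefficients up to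
      degree \<open>t\<close>.\<close>
    have "(\<Prod>c\<in>?D. x (T c)) = x (T c) * (\<Prod>c\<in>?D - {c}. x (T c))"
      using fin c(1) by (rule prod.remove)
    also have "\<dots> $ t = 0"
      using x[of _ "T c"] c(2) by (simp add: fps_mult_nth)
    finally show "(\<Prod>c\<in>?D. x (T c)) $ t = 0" .
  qed (use fin in \<open>simp_all add: schur_poly_def fps_sum_nth\<close>)
  then have "schur x \<mu> = ?S" unfolding schur_def by (rule infsumI)
  then show ?thesis using assms(3) by (simp add: max_absorb2)
qed

lemma schur_nth_eq_0:
  fixes x :: "nat \<Rightarrow> 'a::comm_ring_1 fps"
  assumes x: "\<And>i t. t \<le> i \<Longrightarrow> x i $ t = 0" and fin: "finite (young_diagram \<mu>)"
    and "n < card (young_diagram \<mu>)"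
  shows "schur x \<mu> $ n = 0"
proof -
  have "schur x \<mu> $ n = schur_poly x n (young_diagram \<mu>) $ n"
    by (rule schur_nth) (use x fin in auto)
  also have "\<dots> = 0"
    unfolding schur_poly_def fps_sum_nth
    by (intro sum.neutral ballI fps_prod_nth_eq_0) (use assms in auto)
  finally show ?thesis .
qed

section \<open>Partitions with at most \<open>k\<close> parts as strictly decreasing
  sequences\<close>

lemma decr_funs_gap:
  assumes "c \<in> decr_funs k n" "i \<le> j" "j < k"
  shows "c j + (j - i) \<le> c i"
  using assms(2,3)
proof (induction j rule: dec_induct)
  case (step j)
  then have "c (Suc j) < c j" using assms(1) by (simp add: decr_funs_def)
  then show ?case using step by simp
qed simp

text \<open>Zeros stand at the end of a decreasing list, so deleting them moves no other part, and
  the padding of \<open>row_length\<close> restores them.\<close>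

lemma row_length_filter_pos:
  "sorted_wrt (\<ge>) l \<Longrightarrow> row_length (filter (\<lambda>p. 0 < p) l) j = row_length l j"
proof (induction l arbitrary: j)
  case (Cons a l)
  show ?case
  proof (cases "a = 0")
    case True
    then have "\<forall>p\<in>set l. p = 0" using Cons.prems by simp
    then show ?thesis using True
      by (auto simp: row_length_def nth_Cons' filter_empty_conv)
  next
    case False
    have "row_length (b # bs) (Suc i) = row_length bs i" "row_length (b # bs) 0 = b" for b bs i
      by (auto simp: row_length_def)
    then show ?thesis using False Cons by (cases j) simp_all
  qed
qed simp

text \<open>Adding the staircase \<open>k - 1, ..., 1, 0\<close> makes a weakly decreasing sequence
  strict. Parts at most \<open>n\<close> become values at most \<open>n + k - 1\<close>, hence the
  range \<open>n + k\<close>.\<close>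

lemma bij_betw_partitions_decr_funs:
  "bij_betw (\<lambda>\<mu>. \<lambda>j\<in>{..<k}. row_length \<mu> j + (k - 1 - j))
     {\<mu>. int_partition \<mu> \<and> length \<mu> \<le> k \<and> (\<forall>p\<in>set \<mu>. p \<le> n)} (decr_funs k (n + k))"
proof (rule bij_betw_byWitness[where
      f' = "\<lambda>c. filter (\<lambda>p. 0 < p) (map (\<lambda>j. c j - (k - 1 - j)) [0..<k])"])
  let ?P = "{\<mu>. int_partition \<mu> \<and> length \<mu> \<le> k \<and> (\<forall>p\<in>set \<mu>. p \<le> n)}"
  let ?shift = "\<lambda>\<mu>. \<lambda>j\<in>{..<k}. row_length \<mu> j + (k - 1 - j)"
  let ?l = "\<lambda>c. map (\<lambda>j. c j - (k - 1 - j)) [0..<k]"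
  show "\<forall>\<mu>\<in>?P. filter (\<lambda>p. 0 < p) (?l (?shift \<mu>)) = \<mu>"
  proof
    fix \<mu> assume \<mu>: "\<mu> \<in> ?P"
    have "?l (?shift \<mu>) = \<mu> @ replicate (k - length \<mu>) 0"
      using \<mu> by (intro nth_equalityI) (auto simp: row_length_def nth_append)
    then show "filter (\<lambda>p. 0 < p) (?l (?shift \<mu>)) = \<mu>"
      using \<mu> by (simp add: int_partition_def)
  qed
  have sorted: "sorted_wrt (\<ge>) (?l c)" if c: "c \<in> decr_funs k (n + k)" for c
    unfolding sorted_wrt_iff_nth_less
  proof (intro allI impI)
    fix i j assume "i < j" "j < length (?l c)"
    then show "?l c ! j \<le> ?l c ! i" using decr_funs_gap[OF c, of i j] by auto
  qed
  show "\<forall>c\<in>decr_funs k (n + k). ?shift (filter (\<lambda>p. 0 < p) (?l c)) = c"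
  proof
    fix c assume c: "c \<in> decr_funs k (n + k)"
    \<comment> \<open>The later values force \<open>c j\<close> to be at least the staircase, so the
      truncated subtraction loses nothing.\<close>
    have ge: "k - 1 - j \<le> c j" if "j < k" for j
    proof -
      have "j \<le> k - 1" "k - 1 < k" using that by auto
      from decr_funs_gap[OF c this] show ?thesis by simp
    qed
    have row: "row_length (filter (\<lambda>p. 0 < p) (?l c)) j = c j - (k - 1 - j)" if "j < k" for j
      unfolding row_length_filter_pos[OF sorted[OF c]] using that by (simp add: row_length_def)
    have "c \<in> extensional {..<k}" using c by (simp add: decr_funs_def PiE_def)
    moreover have "restrict (\<lambda>j. row_length (filter (\<lambda>p. 0 < p) (?l c)) j + (k - 1 - j)) {..<k} = restrict c {..<k}"
      by (rule restrict_ext) (simp only: row ge le_add_diff_inverse2 lessThan_iff)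
    ultimately show "?shift (filter (\<lambda>p. 0 < p) (?l c)) = c"
      by (simp only: extensional_restrict)
  qed
  show "?shift ` ?P \<subseteq> decr_funs k (n + k)"
  proof clarify
    fix \<mu> assume \<mu>: "int_partition \<mu>" "length \<mu> \<le> k" "\<forall>p\<in>set \<mu>. p \<le> n"
    have "row_length \<mu> j \<le> n" for j using \<mu>(3) by (auto simp: row_length_def)
    then have "row_length \<mu> j + (k - 1 - j) < n + k" if "j < k" for j
      using that by (intro add_le_less_mono) auto
    moreover have "row_length \<mu> j \<le> row_length \<mu> i" if "i < j" "j < k" for i j
      using decreasing_rows_row_length[OF \<mu>(1), of k] that by (auto simp: decreasing_rows_def)
    then have "row_length \<mu> j + (k - 1 - j) < row_length \<mu> i + (k - 1 - i)" if "i < j" "j < k" for i j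
      using that by (intro add_le_less_mono) auto
    ultimately show "?shift \<mu> \<in> decr_funs k (n + k)"
      unfolding decr_funs_def by simp
  qed
  show "(\<lambda>c. filter (\<lambda>p. 0 < p) (?l c)) ` decr_funs k (n + k) \<subseteq> ?P"
  proof clarify
    fix c assume c: "c \<in> decr_funs k (n + k)"
    have "c j - (k - 1 - j) \<le> n" if j: "j < k" for j
    proof -
      have "c 0 < n + k" using c j by (auto simp: decr_funs_def PiE_def)
      then show ?thesis using decr_funs_gap[OF c, of 0 j] j by simp
    qed
    then show "int_partition (filter (\<lambda>p. 0 < p) (?l c)) \<and> length (filter (\<lambda>p. 0 < p) (?l c)) \<le> k \<and>
      (\<forall>p\<in>set (filter (\<lambda>p. 0 < p) (?l c)). p \<le> n)"
      using sorted_wrt_filter[OF sorted[OF c]] length_filter_le[of "\<lambda>p. 0 < p" "?l c"]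
      by (auto simp: int_partition_def)
  qed
qed

theorem theorem8p1:
  fixes k :: nat
  assumes "k \<ge> 1"
  shows "((\<lambda>\<mu>. schur (\<lambda>i. fps_X ^ (2 * i + 2)) \<mu> * schur (\<lambda>i. fps_X ^ (2 * i + 1)) \<mu>)
           has_sum det (mat k k (\<lambda>(i, j). pairing_rank_gf (int i - int j))))
         {\<mu>. int_partition \<mu> \<and> length \<mu> \<le> k}"
proof -
  let ?x = "\<lambda>i. fps_X ^ (2 * i + 2) :: int fps"
  let ?y = "\<lambda>i. fps_X ^ (2 * i + 1) :: int fps"
  let ?P = "\<lambda>n. {\<mu>. int_partition \<mu> \<and> length \<mu> \<le> k \<and> (\<forall>p\<in>set \<mu>. p \<le> n)}"
  let ?c = "\<lambda>\<mu>. \<lambda>j\<in>{..<k}. row_length \<mu> j + (k - 1 - j)"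
  \<comment> \<open>Row \<open>i\<close> is shifted by the staircase entry \<open>k - 1 - i\<close>,
    so choosing column \<open>row_length \<mu> j + (k - 1 - j)\<close> produces the Jacobi--Trudi
    index \<open>row_length \<mu> j + i - j\<close>.\<close>
  let ?A = "\<lambda>x n i c. complete_sym_int x n (int c - int (k - 1 - i)) :: int fps"
  let ?det = "\<lambda>x n f. det (mat k k (\<lambda>(i, j). ?A x n i (f j)))"
  have x: "?x i $ t = 0" and y: "?y i $ t = 0" if "t \<le> i" for i t using that by auto
  have fin: "finite (young_diagram \<mu>)" if "length \<mu> \<le> k" for \<mu>
    using young_diagram_eq[OF that] by simp
  have schur: "fps_agree n (schur z \<mu>) (?det z n (?c \<mu>))"
    if \<mu>: "int_partition \<mu>" "length \<mu> \<le> k" and z: "\<And>i t. t \<le> i \<Longrightarrow> z i $ t = 0" for n \<mu> z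
  proof -
    have "?det z n (?c \<mu>) = jacobi_trudi z n k (row_length \<mu>)"
      unfolding jacobi_trudi_def
      by (rule det_cong) (auto intro!: arg_cong[of _ _ "complete_sym_int z n"])
    also have "\<dots> = schur_poly z n (young_diagram \<mu>)"
      unfolding young_diagram_eq[OF \<mu>(2)]
      by (rule schur_poly_eq_jacobi_trudi[OF decreasing_rows_row_length[OF \<mu>(1)], symmetric])
    finally show ?thesis
      using schur_nth[OF z fin[OF \<mu>(2)]] by (auto simp: fps_agree_def)
  qed
  show ?thesis
  proof (rule fps_has_sumI[where F = ?P])
    fix n
    show "finite (?P n)"
      using bij_betw_finite[OF bij_betw_partitions_decr_funs[of k n]] by simp
    have "fps_agree n (det (mat k k (\<lambda>(i, j). pairing_rank_gf (int i - int j))))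
        (det (mat k k (\<lambda>(i, j). \<Sum>c<n + k. ?A ?x n i c * ?A ?y n j c)))"
    proof (rule fps_agree_det)
      fix i j assume ij: "i < k" "j < k"
      \<comment> \<open>The rank is rewritten with the row and column shifts. Both are below
        \<open>k\<close>, so \<open>n + k\<close> inner indices suffice for all coefficients up to
        \<open>n\<close>.\<close>
      have eq: "int i - int j = int (k - 1 - j) - int (k - 1 - i)" using ij by simp
      show "fps_agree n (pairing_rank_gf (int i - int j)) (\<Sum>c<n + k. ?A ?x n i c * ?A ?y n j c)"
        unfolding fps_agree_def eq using ij by (intro allI impI pairing_rank_gf_nth) auto
    qed
    then have "det (mat k k (\<lambda>(i, j). pairing_rank_gf (int i - int j))) $ n =
        (\<Sum>f\<in>decr_funs k (n + k). ?det ?x n f * ?det ?y n f) $ n"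
      unfolding cauchy_binet by (simp add: fps_agree_def)
    also have "\<dots> = (\<Sum>\<mu>\<in>?P n. (?det ?x n (?c \<mu>) * ?det ?y n (?c \<mu>)) $ n)"
      unfolding fps_sum_nth
      by (rule sum.reindex_bij_betw[OF bij_betw_partitions_decr_funs, symmetric])
    also have "\<dots> = (\<Sum>\<mu>\<in>?P n. (schur ?x \<mu> * schur ?y \<mu>) $ n)"
    proof (rule sum.cong[OF refl])
      fix \<mu> assume "\<mu> \<in> ?P n"
      then have \<mu>: "int_partition \<mu>" "length \<mu> \<le> k" by auto
      from fps_agree_mult[OF schur[OF \<mu>, where z = ?x and n = n, OF x]
          schur[OF \<mu>, where z = ?y and n = n, OF y]]
      show "(?det ?x n (?c \<mu>) * ?det ?y n (?c \<mu>)) $ n = (schur ?x \<mu> * schur ?y \<mu>) $ n"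
        by (simp only: fps_agree_def)
    qed
    finally show "det (mat k k (\<lambda>(i, j). pairing_rank_gf (int i - int j))) $ n =
        (\<Sum>\<mu>\<in>?P n. (schur ?x \<mu> * schur ?y \<mu>) $ n)" .
  next
    fix n \<mu> assume "\<mu> \<in> {\<mu>. int_partition \<mu> \<and> length \<mu> \<le> k}" "\<mu> \<notin> ?P n"
    then obtain i where \<mu>: "length \<mu> \<le> k" "i < length \<mu>" "n < \<mu> ! i"
      by (auto simp: in_set_conv_nth not_le)
    \<comment> \<open>A single row longer than \<open>n\<close> already gives the diagram more than
      \<open>n\<close> cells, so both Schur functions vanish up to degree \<open>n\<close>.\<close>
    have "card (Pair i ` {..<\<mu> ! i}) \<le> card (young_diagram \<mu>)"
      using \<mu> fin by (intro card_mono) (auto simp: young_diagram_def)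
    then have "n < card (young_diagram \<mu>)" using \<mu>(3) by (simp add: card_image inj_on_def)
    then have "schur ?x \<mu> $ t = 0" if "t \<le> n" for t
      using that by (intro schur_nth_eq_0[OF x fin[OF \<mu>(1)]]) auto
    then show "(schur ?x \<mu> * schur ?y \<mu>) $ n = 0"
      by (simp add: fps_mult_nth)
  qed auto
qed

end
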